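(* Let $\pi:G\to\overline{G}$ be an epimorphism of abelian groups with kernel $H$ and let $\chi:G\to U\subset\mathbb{C}^\times$ be a character. Let $\mathcal{A}$ and $\mathcal{A}'$ be central simple algebras over $\mathbb{R}$ equipped with $\overline{G}$-gradings. Then $L_\pi^\chi(\mathcal{A})$ and $L_\pi^\chi(\mathcal{A}')$ are isomorphic as $G$-graded algebras if and only if the $\overline{G}$-graded algebra $\mathcal{A}'$ is isomorphic to a twist of $\mathcal{A}$, i.e., to $\mathcal{A}^\lambda$ for some character $\lambda:H\to\mathbb{R}^\times$.
   Context: Algebras are not assumed associative, unital or finite-dimensional. Isomorphisms of graded algebras are algebra isomorphisms preserving degrees. Central simple over $\mathbb{R}$ means simple with centroid (the algebra of linear operators commuting with all left and right multiplications) equal to $\mathbb{R}$. Let $U=\{z\in\mathbb{C}:|z|=1\}$. For each $g\in G$ choose $z_g\in U$ with $z_g^2=\chi(g)$ and put $u_g=z_g\otimes g\in\mathbb{C}\otimes_{\mathbb{R}}\mathbb{R}G=\mathbb{C}G$. For a $\overline{G}$-graded real algebra $\mathcal{A}$, the loop algebra is the real subalgebra $L_\pi^\chi(\mathcal{A})=\bigoplus_{g\in G}\mathcal{A}_{\pi(g)}\otimes u_g\subset\mathcal{A}\otimes_{\mathbb{R}}\mathbb{C}G$, $G$-graded with $L_\pi^\chi(\mathcal{A})_g=\mathcal{A}_{\pi(g)}\otimes u_g$. Twists: fix a set-theoretic section $\xi:\overline{G}\to G$ of $\pi$ and let $\sigma(\bar g_1,\bar g_2)=\xi(\bar g_1)\xi(\bar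 g_2)\xi(\bar g_1\bar g_2)^{-1}\in H$. For a character $\lambda:H\to\mathbb{R}^\times$, $\mathcal{A}^\lambda$ is $\mathcal{A}$ as a $\overline{G}$-graded space with the multiplication $a_1\ast a_2=\lambda(\sigma(\bar g_1,\bar g_2))a_1a_2$ for $a_1\in\mathcal{A}_{\bar g_1}$, $a_2\in\mathcal{A}_{\bar g_2}$. The isomorphism class of $\mathcal{A}^\lambda$ does not depend on the choice of $\xi$. *)

theory Defs
  imports "HOL-Analysis.Analysis" "HOL-Analysis.Finite_Function_Topology"
begin

text \<open>
  Abelian groups are types of class \<open>ab_group_add\<close> and are written additively.
  A real algebra consists of a subspace of some real vector space together with a product that is
  bilinear on it; the product is not required to be associative or unital, and its
  values outside the subspace are irrelevant.
\<close>

record 'v alg =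
  carr :: "'v set"
  mul :: "'v \<Rightarrow> 'v \<Rightarrow> 'v"

record ('v, 'g) graded_alg = "'v alg" +
  homog :: "'g \<Rightarrow> 'v set"

definition linear_on :: "'v::real_vector set \<Rightarrow> ('v \<Rightarrow> 'w::real_vector) \<Rightarrow> bool" where
  "linear_on V f \<longleftrightarrow>
     (\<forall>x\<in>V. \<forall>y\<in>V. f (x + y) = f x + f y) \<and> (\<forall>r. \<forall>x\<in>V. f (r *\<^sub>R x) = r *\<^sub>R f x)"

definition real_alg :: "('v::real_vector, 'm) alg_scheme \<Rightarrow> bool" where
  "real_alg A \<longleftrightarrow>
     subspace (carr A) \<and>
     (\<forall>x\<in>carr A. \<forall>y\<in>carr A. mul A x y \<in> carr A) \<and>
     (\<forall>x\<in>carr A. linear_on (carr A) (\<lambda>y. mul A x y) \<and> linear_on (carr A) (\<lambda>y. mul A y x))"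

definition alg_ideal :: "('v::real_vector, 'm) alg_scheme \<Rightarrow> 'v set \<Rightarrow> bool" where
  "alg_ideal A I \<longleftrightarrow>
     subspace I \<and> I \<subseteq> carr A \<and> (\<forall>x\<in>carr A. \<forall>y\<in>I. mul A x y \<in> I \<and> mul A y x \<in> I)"

definition simple_alg :: "('v::real_vector, 'm) alg_scheme \<Rightarrow> bool" where
  "simple_alg A \<longleftrightarrow>
     (\<exists>x\<in>carr A. \<exists>y\<in>carr A. mul A x y \<noteq> 0) \<and>
     (\<forall>I. alg_ideal A I \<longrightarrow> I = {0} \<or> I = carr A)"

definition centroid :: "('v::real_vector, 'm) alg_scheme \<Rightarrow> ('v \<Rightarrow> 'v) set" where
  "centroid A = {f \<in> carr A \<rightarrow>\<^sub>E carr A. linear_on (carr A) f \<and>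
     (\<forall>x\<in>carr A. \<forall>y\<in>carr A. f (mul A x y) = mul A x (f y) \<and> f (mul A x y) = mul A (f x) y)}"

definition central_simple :: "('v::real_vector, 'm) alg_scheme \<Rightarrow> bool" where
  "central_simple A \<longleftrightarrow>
     real_alg A \<and> simple_alg A \<and>
     centroid A = range (\<lambda>r. restrict (\<lambda>x. r *\<^sub>R x) (carr A))"

definition homog_decomp ::
  "('v::real_vector, 'g, 'm) graded_alg_scheme \<Rightarrow> 'v \<Rightarrow> ('g \<Rightarrow>\<^sub>0 'v) \<Rightarrow> bool" where
  "homog_decomp A x c \<longleftrightarrow>
     (\<forall>g. Poly_Mapping.lookup c g \<in> homog A g) \<and>
     x = (\<Sum>g\<in>Poly_Mapping.keys c. Poly_Mapping.lookup c g)"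

text \<open>The second and third conditions say that the carrier is the direct sum of the
  homogeneous components.\<close>

definition graded_real_alg ::
  "('v::real_vector, 'g::ab_group_add, 'm) graded_alg_scheme \<Rightarrow> bool" where
  "graded_real_alg A \<longleftrightarrow>
     real_alg A \<and>
     (\<forall>g. subspace (homog A g) \<and> homog A g \<subseteq> carr A) \<and>
     (\<forall>x\<in>carr A. \<exists>!c. homog_decomp A x c) \<and>
     (\<forall>g h. \<forall>x\<in>homog A g. \<forall>y\<in>homog A h. mul A x y \<in> homog A (g + h))"

definition homog_parts ::
  "('v::real_vector, 'g, 'm) graded_alg_scheme \<Rightarrow> 'v \<Rightarrow> ('g \<Rightarrow>\<^sub>0 'v)" where
  "homog_parts A x = (THE c. homog_decomp A x c)"

definition graded_isomorphic ::
  "('v::real_vector, 'g, 'm) graded_alg_scheme \<Rightarrow>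
   ('w::real_vector, 'g, 'n) graded_alg_scheme \<Rightarrow> bool" where
  "graded_isomorphic A B \<longleftrightarrow>
     (\<exists>f. bij_betw f (carr A) (carr B) \<and> linear_on (carr A) f \<and>
        (\<forall>x\<in>carr A. \<forall>y\<in>carr A. f (mul A x y) = mul B (f x) (f y)) \<and>
        (\<forall>g. f ` homog A g = homog B g))"

text \<open>
  The group algebra \<open>\<complex>G\<close> is the type \<open>'g \<Rightarrow>\<^sub>0 complex\<close> with its convolution product. The real
  tensor product of a real vector space with \<open>\<complex>G\<close> is realised as the space of finitely supported
  functions from \<open>G\<close> to the complexification, where a pair \<open>(a, b)\<close> stands for \<open>a \<otimes> 1 + b \<otimes> \<i>\<close>.
  The lemmas \<open>tensor_universal\<close> and \<open>tensor_mul_tensor\<close> below justify this.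
\<close>

definition tensor ::
  "'v::real_vector \<Rightarrow> ('g \<Rightarrow>\<^sub>0 complex) \<Rightarrow> ('g \<Rightarrow>\<^sub>0 'v \<times> 'v)" where
  "tensor a p = Poly_Mapping.map (\<lambda>c. (Re c *\<^sub>R a, Im c *\<^sub>R a)) p"

definition complexified_mul ::
  "('v::real_vector \<Rightarrow> 'v \<Rightarrow> 'v) \<Rightarrow> 'v \<times> 'v \<Rightarrow> 'v \<times> 'v \<Rightarrow> 'v \<times> 'v" where
  "complexified_mul m x y =
     (m (fst x) (fst y) - m (snd x) (snd y), m (fst x) (snd y) + m (snd x) (fst y))"

definition tensor_mul ::
  "('v::real_vector \<Rightarrow> 'v \<Rightarrow> 'v) \<Rightarrow> ('g::ab_group_add \<Rightarrow>\<^sub>0 'v \<times> 'v) \<Rightarrow> ('g \<Rightarrow>\<^sub>0 'v \<times> 'v) \<Rightarrow>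
   ('g \<Rightarrow>\<^sub>0 'v \<times> 'v)" where
  "tensor_mul m s t =
     (\<Sum>g\<in>Poly_Mapping.keys s. \<Sum>h\<in>Poly_Mapping.keys t.
        Poly_Mapping.single (g + h)
          (complexified_mul m (Poly_Mapping.lookup s g) (Poly_Mapping.lookup t h)))"

lemma lookup_scaleR_poly_mapping:
  "Poly_Mapping.lookup (r *\<^sub>R x) g = r *\<^sub>R Poly_Mapping.lookup x g"
proof -
  have "finite {i. r *\<^sub>R Poly_Mapping.lookup x i \<noteq> 0}"
    by (rule finite_subset[OF _ finite_lookup[of x]]) auto
  then show ?thesis
    by (simp add: scaleR_poly_mapping_def Abs_poly_mapping_inverse)
qed

lemma lookup_tensor:
  "Poly_Mapping.lookup (tensor a p) g =
     (Re (Poly_Mapping.lookup p g) *\<^sub>R a, Im (Poly_Mapping.lookup p g) *\<^sub>R a)"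
  by (auto simp: tensor_def Poly_Mapping.map.rep_eq when_def zero_prod_def)

lemma tensor_single:
  "tensor a (Poly_Mapping.single g c) = Poly_Mapping.single g (Re c *\<^sub>R a, Im c *\<^sub>R a)"
  by (simp add: tensor_def zero_prod_def)

lemma linear_tensor_left: "linear (\<lambda>a. tensor a p)"
  by (rule linearI; rule poly_mapping_eqI)
    (simp_all add: lookup_tensor lookup_scaleR_poly_mapping lookup_add algebra_simps)

lemma linear_tensor_right: "linear (\<lambda>p. tensor a p)"
  by (rule linearI; rule poly_mapping_eqI)
    (simp_all add: lookup_tensor lookup_scaleR_poly_mapping lookup_add algebra_simps)

lemma poly_mapping_expansion:
  "(\<Sum>g\<in>Poly_Mapping.keys p. Poly_Mapping.single g (Poly_Mapping.lookup p g)) = p"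
proof (rule poly_mapping_eqI)
  fix k
  show "Poly_Mapping.lookup
      (\<Sum>g\<in>Poly_Mapping.keys p. Poly_Mapping.single g (Poly_Mapping.lookup p g)) k =
      Poly_Mapping.lookup p k"
    by (simp add: lookup_sum lookup_single when_def in_keys_iff)
qed

lemma linear_single: "linear (\<lambda>x. Poly_Mapping.single g x)"
  by (rule linearI; rule poly_mapping_eqI)
    (simp_all add: lookup_scaleR_poly_mapping lookup_add lookup_single when_def)

lemma linear_poly_mapping_sum:
  assumes "\<And>g. linear (\<phi> g)"
  shows "linear (\<lambda>s. \<Sum>g\<in>Poly_Mapping.keys s. \<phi> g (Poly_Mapping.lookup s g))"
proof (rule linearI)
  fix x y :: "'a \<Rightarrow>\<^sub>0 'b" and r :: real
  show "(\<Sum>g\<in>Poly_Mapping.keys (x + y). \<phi> g (Poly_Mapping.lookup (x + y) g)) =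
      (\<Sum>g\<in>Poly_Mapping.keys x. \<phi> g (Poly_Mapping.lookup x g)) +
      (\<Sum>g\<in>Poly_Mapping.keys y. \<phi> g (Poly_Mapping.lookup y g))"
    by (rule setsum_keys_plus_distrib) (use assms linear_0 linear_add in blast)+
  have "(\<Sum>g\<in>Poly_Mapping.keys (r *\<^sub>R x). \<phi> g (Poly_Mapping.lookup (r *\<^sub>R x) g)) =
      (\<Sum>g\<in>Poly_Mapping.keys x. \<phi> g (Poly_Mapping.lookup (r *\<^sub>R x) g))"
    by (rule sum.mono_neutral_left)
      (auto simp: lookup_scaleR_poly_mapping in_keys_iff linear_0[OF assms])
  then show "(\<Sum>g\<in>Poly_Mapping.keys (r *\<^sub>R x). \<phi> g (Poly_Mapping.lookup (r *\<^sub>R x) g)) =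
      r *\<^sub>R (\<Sum>g\<in>Poly_Mapping.keys x. \<phi> g (Poly_Mapping.lookup x g))"
    by (simp add: lookup_scaleR_poly_mapping linear_scale[OF assms] scaleR_sum_right)
qed

theorem tensor_universal:
  fixes \<beta> :: "'v::real_vector \<Rightarrow> ('g \<Rightarrow>\<^sub>0 complex) \<Rightarrow> 'u::real_vector"
  assumes lin_left: "\<And>p. linear (\<lambda>a. \<beta> a p)" and lin_right: "\<And>a. linear (\<beta> a)"
  shows "\<exists>!F. linear F \<and> (\<forall>a p. F (tensor a p) = \<beta> a p)"
proof -
  define \<phi> where "\<phi> = (\<lambda>g (x :: 'v \<times> 'v).
    \<beta> (fst x) (Poly_Mapping.single g 1) + \<beta> (snd x) (Poly_Mapping.single g \<i>))"
  have lin_\<phi>: "linear (\<phi> g)" for g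
    by (rule linearI)
      (simp_all add: \<phi>_def linear_add[OF lin_left] linear_scale[OF lin_left] algebra_simps)
  define F where "F = (\<lambda>s. \<Sum>g\<in>Poly_Mapping.keys s. \<phi> g (Poly_Mapping.lookup s g))"
  have lin_F: "linear F"
    unfolding F_def by (rule linear_poly_mapping_sum) (rule lin_\<phi>)
  have F_single: "F (Poly_Mapping.single g x) = \<phi> g x" for g x
    using linear_0[OF lin_\<phi>] by (auto simp: F_def)
  have single_c: "Poly_Mapping.single g c =
      Re c *\<^sub>R Poly_Mapping.single g 1 + Im c *\<^sub>R Poly_Mapping.single g \<i>" for g :: 'g and c
    by (rule poly_mapping_eqI)
      (auto simp: lookup_add lookup_scaleR_poly_mapping lookup_single when_def complex_eq_iff)
  have F_pure: "F (tensor a p) = \<beta> a p" for a p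
  proof -
    have "F (tensor a p) = F (tensor a
        (\<Sum>g\<in>Poly_Mapping.keys p. Poly_Mapping.single g (Poly_Mapping.lookup p g)))"
      by (simp add: poly_mapping_expansion)
    also have "\<dots> = (\<Sum>g\<in>Poly_Mapping.keys p.
        \<phi> g (Re (Poly_Mapping.lookup p g) *\<^sub>R a, Im (Poly_Mapping.lookup p g) *\<^sub>R a))"
      by (simp add: linear_sum[OF linear_tensor_right] linear_sum[OF lin_F] tensor_single F_single)
    also have "\<dots> = (\<Sum>g\<in>Poly_Mapping.keys p.
        \<beta> a (Poly_Mapping.single g (Poly_Mapping.lookup p g)))"
    proof (rule sum.cong[OF refl])
      fix g
      show "\<phi> g (Re (Poly_Mapping.lookup p g) *\<^sub>R a, Im (Poly_Mapping.lookup p g) *\<^sub>R a) =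
          \<beta> a (Poly_Mapping.single g (Poly_Mapping.lookup p g))"
        unfolding single_c[of g "Poly_Mapping.lookup p g"]
        by (simp add: \<phi>_def linear_scale[OF lin_left] linear_add[OF lin_right]
            linear_scale[OF lin_right])
    qed
    also have "\<dots> = \<beta> a p"
      by (simp add: linear_sum[OF lin_right, symmetric] poly_mapping_expansion)
    finally show ?thesis .
  qed
  show ?thesis
  proof (rule ex1I[of _ F])
    show "linear F \<and> (\<forall>a p. F (tensor a p) = \<beta> a p)"
      using lin_F F_pure by blast
  next
    fix F' assume F': "linear F' \<and> (\<forall>a p. F' (tensor a p) = \<beta> a p)"
    have "F' s = F s" for s
    proof -
      have s: "s = (\<Sum>g\<in>Poly_Mapping.keys s.
          tensor (fst (Poly_Mapping.lookup s g)) (Poly_Mapping.single g 1) +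
          tensor (snd (Poly_Mapping.lookup s g)) (Poly_Mapping.single g \<i>))"
        by (subst poly_mapping_expansion[of s, symmetric])
          (rule sum.cong[OF refl], simp add: tensor_single single_add[symmetric])
      show ?thesis
        by (subst (1 2) s)
          (use F' F_pure in \<open>simp add: linear_sum[of F'] linear_sum[OF lin_F]
            linear_add[of F'] linear_add[OF lin_F]\<close>)
    qed
    then show "F' = F" by blast
  qed
qed

lemma linear_on_0: "subspace V \<Longrightarrow> linear_on V f \<Longrightarrow> f 0 = 0"
  unfolding linear_on_def by (metis scaleR_zero_left subspace_0)

lemma complexified_mul_tensor:
  assumes "real_alg A" "a \<in> carr A" "b \<in> carr A"
  shows "complexified_mul (mul A) (Re c *\<^sub>R a, Im c *\<^sub>R a) (Re d *\<^sub>R b, Im d *\<^sub>R b) =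
    (Re (c * d) *\<^sub>R mul A a b, Im (c * d) *\<^sub>R mul A a b)"
proof -
  have "mul A (r *\<^sub>R a) (s *\<^sub>R b) = (r * s) *\<^sub>R mul A a b" for r s
    using assms unfolding real_alg_def linear_on_def
    by (metis scaleR_scaleR subspace_scale)
  then show ?thesis
    by (simp add: complexified_mul_def algebra_simps)
qed

theorem tensor_mul_tensor:
  assumes A: "real_alg A" "a \<in> carr A" "b \<in> carr A"
  shows "tensor_mul (mul A) (tensor a p) (tensor b q) = tensor (mul A a b) (p * q)"
proof -
  let ?f = "\<lambda>g h. Poly_Mapping.single (g + h) (complexified_mul (mul A)
      (Poly_Mapping.lookup (tensor a p) g) (Poly_Mapping.lookup (tensor b q) h))"
  have f: "?f g h = tensor (mul A a b)
      (Poly_Mapping.single g (Poly_Mapping.lookup p g) *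
       Poly_Mapping.single h (Poly_Mapping.lookup q h))" for g h
    by (simp add: lookup_tensor complexified_mul_tensor[OF A] mult_single tensor_single)
  have zero: "?f g h = 0"
    if "g \<notin> Poly_Mapping.keys (tensor a p) \<or> h \<notin> Poly_Mapping.keys (tensor b q)" for g h
  proof -
    have "mul A a b = 0 \<or> Poly_Mapping.lookup p g = 0 \<or> Poly_Mapping.lookup q h = 0"
      using that A linear_on_0[of "carr A" "\<lambda>x. mul A x b"] linear_on_0[of "carr A" "mul A a"]
      unfolding real_alg_def
      by (auto simp: in_keys_iff lookup_tensor complex_eq_iff zero_prod_def)
    then show ?thesis
      unfolding f by (auto simp: linear_0[OF linear_tensor_left] linear_0[OF linear_tensor_right])
  qed
  have sub: "Poly_Mapping.keys (tensor a p) \<subseteq> Poly_Mapping.keys p"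
    "Poly_Mapping.keys (tensor b q) \<subseteq> Poly_Mapping.keys q"
    by (auto simp: in_keys_iff lookup_tensor zero_prod_def)
  have "tensor_mul (mul A) (tensor a p) (tensor b q) =
      (\<Sum>g\<in>Poly_Mapping.keys (tensor a p). \<Sum>h\<in>Poly_Mapping.keys (tensor b q). ?f g h)"
    by (simp add: tensor_mul_def)
  also have "\<dots> = (\<Sum>g\<in>Poly_Mapping.keys (tensor a p). \<Sum>h\<in>Poly_Mapping.keys q. ?f g h)"
    by (rule sum.cong[OF refl], rule sum.mono_neutral_left) (use sub zero in auto)
  also have "\<dots> = (\<Sum>g\<in>Poly_Mapping.keys p. \<Sum>h\<in>Poly_Mapping.keys q. ?f g h)"
    by (rule sum.mono_neutral_left) (use sub zero in \<open>auto intro!: sum.neutral\<close>)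
  also have "\<dots> = tensor (mul A a b)
      ((\<Sum>g\<in>Poly_Mapping.keys p. Poly_Mapping.single g (Poly_Mapping.lookup p g)) *
       (\<Sum>h\<in>Poly_Mapping.keys q. Poly_Mapping.single h (Poly_Mapping.lookup q h)))"
    unfolding f by (simp add: sum_product linear_sum[OF linear_tensor_right])
  also have "\<dots> = tensor (mul A a b) (p * q)"
    by (simp add: poly_mapping_expansion)
  finally show ?thesis .
qed

text \<open>The loop algebra depends on the character only through the chosen square roots \<open>z g\<close>
  of its values; \<open>Poly_Mapping.single g (z g)\<close> is the element \<open>u\<^sub>g\<close> of \<open>\<complex>G\<close>.\<close>

definition loop_component ::
  "('g::ab_group_add \<Rightarrow> 'h) \<Rightarrow> ('g \<Rightarrow> complex) \<Rightarrow> ('v::real_vector, 'h, 'm) graded_alg_scheme \<Rightarrow>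
   'g \<Rightarrow> ('g \<Rightarrow>\<^sub>0 'v \<times> 'v) set" where
  "loop_component \<pi> z A g =
     (\<lambda>a. tensor a (Poly_Mapping.single g (z g))) ` homog A (\<pi> g)"

definition loop_alg ::
  "('g::ab_group_add \<Rightarrow> 'h) \<Rightarrow> ('g \<Rightarrow> complex) \<Rightarrow> ('v::real_vector, 'h, 'm) graded_alg_scheme \<Rightarrow>
   ('g \<Rightarrow>\<^sub>0 'v \<times> 'v, 'g) graded_alg" where
  "loop_alg \<pi> z A =
     \<lparr>carr = span (\<Union>g. loop_component \<pi> z A g),
      mul = tensor_mul (mul A),
      homog = loop_component \<pi> z A\<rparr>"

definition unitary_character :: "('g::ab_group_add \<Rightarrow> complex) \<Rightarrow> bool" where
  "unitary_character \<psi> \<longleftrightarrow>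
     (\<forall>g. cmod (\<psi> g) = 1) \<and> (\<forall>g h. \<psi> (g + h) = \<psi> g * \<psi> h)"

definition ker :: "('g \<Rightarrow> 'h::zero) \<Rightarrow> 'g set" where
  "ker \<pi> = {g. \<pi> g = 0}"

text \<open>Characters of a subgroup \<open>H\<close> are total functions; only their values on \<open>H\<close> matter.\<close>

definition real_character_on :: "'g::ab_group_add set \<Rightarrow> ('g \<Rightarrow> real) \<Rightarrow> bool" where
  "real_character_on H \<nu> \<longleftrightarrow>
     (\<forall>h\<in>H. \<nu> h \<noteq> 0) \<and> (\<forall>h\<in>H. \<forall>k\<in>H. \<nu> (h + k) = \<nu> h * \<nu> k)"

definition section_cocycle ::
  "('h::ab_group_add \<Rightarrow> 'g::ab_group_add) \<Rightarrow> 'h \<Rightarrow> 'h \<Rightarrow> 'g" where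
  "section_cocycle \<xi> g h = \<xi> g + \<xi> h - \<xi> (g + h)"

definition twist ::
  "('h::ab_group_add \<Rightarrow> 'g::ab_group_add) \<Rightarrow> ('g \<Rightarrow> real) \<Rightarrow>
   ('v::real_vector, 'h) graded_alg \<Rightarrow> ('v, 'h) graded_alg" where
  "twist \<xi> \<nu> A = A\<lparr>mul := \<lambda>x y.
     \<Sum>g\<in>Poly_Mapping.keys (homog_parts A x). \<Sum>h\<in>Poly_Mapping.keys (homog_parts A y).
       \<nu> (section_cocycle \<xi> g h) *\<^sub>R
         mul A (Poly_Mapping.lookup (homog_parts A x) g) (Poly_Mapping.lookup (homog_parts A y) h)\<rparr>"

lemma homog_parts_homogeneous:
  assumes A: "graded_real_alg A" and x: "x \<in> homog A g"
  shows "homog_parts A x = Poly_Mapping.single g x"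
  unfolding homog_parts_def
proof (rule the1_equality)
  show "\<exists>!c. homog_decomp A x c"
    using A x unfolding graded_real_alg_def by blast
  show "homog_decomp A x (Poly_Mapping.single g x)"
    using A x subspace_0 unfolding homog_decomp_def graded_real_alg_def
    by (auto simp: lookup_single when_def)
qed

theorem twist_mul_homogeneous:
  assumes A: "graded_real_alg A" and x: "x \<in> homog A g" and y: "y \<in> homog A h"
  shows "mul (twist \<xi> \<nu> A) x y = \<nu> (section_cocycle \<xi> g h) *\<^sub>R mul A x y"
proof -
  have carr: "x \<in> carr A" "y \<in> carr A"
    using assms unfolding graded_real_alg_def by auto
  then have "mul A x 0 = 0" "mul A 0 y = 0"
    using A linear_on_0[of "carr A" "\<lambda>u. mul A u y"] linear_on_0[of "carr A" "mul A x"]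
    unfolding graded_real_alg_def real_alg_def by auto
  then show ?thesis
    by (auto simp: twist_def homog_parts_homogeneous[OF A x] homog_parts_homogeneous[OF A y])
qed

lemma linear_on_tensor_mul:
  assumes A: "real_alg A"
    and s: "\<And>g. fst (Poly_Mapping.lookup s g) \<in> carr A \<and> snd (Poly_Mapping.lookup s g) \<in> carr A"
  defines "P \<equiv> {t. \<forall>h. fst (Poly_Mapping.lookup t h) \<in> carr A \<and> snd (Poly_Mapping.lookup t h) \<in> carr A}"
  shows "linear_on P (\<lambda>t. tensor_mul (mul A) s t)" "linear_on P (\<lambda>t. tensor_mul (mul A) t s)"
proof -
  let ?C = "carr A \<times> carr A"
  let ?m = "complexified_mul (mul A)"
  have add: "mul A x (y + y') = mul A x y + mul A x y'" "mul A (y + y') x = mul A y x + mul A y' x"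
    and scale: "mul A x (r *\<^sub>R y) = r *\<^sub>R mul A x y" "mul A (r *\<^sub>R y) x = r *\<^sub>R mul A y x"
    if "x \<in> carr A" "y \<in> carr A" "y' \<in> carr A" for x y y' r
    using that A unfolding real_alg_def linear_on_def by blast+
  have madd: "?m x (y + y') = ?m x y + ?m x y'" "?m (y + y') x = ?m y x + ?m y' x"
    and mscale: "?m x (r *\<^sub>R y) = r *\<^sub>R ?m x y" "?m (r *\<^sub>R y) x = r *\<^sub>R ?m y x"
    if "x \<in> ?C" "y \<in> ?C" "y' \<in> ?C" for x y y' r
    using that by (auto simp: complexified_mul_def add scale algebra_simps)
  have C0: "0 \<in> ?C"
    using A unfolding real_alg_def by (simp add: subspace_0 zero_prod_def)
  have m0: "?m x 0 = 0" "?m 0 x = 0" if "x \<in> ?C" for x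
    using mscale[OF that C0 C0, of 0] by simp_all
  have s': "Poly_Mapping.lookup s g \<in> ?C" for g
    using s[of g] by (simp add: mem_Times_iff)
  have P: "Poly_Mapping.lookup t g \<in> ?C" if "t \<in> P" for t g
    using that by (simp add: P_def mem_Times_iff)
  define R where "R = (\<lambda>h y. \<Sum>g\<in>Poly_Mapping.keys s.
      Poly_Mapping.single (g + h) (?m (Poly_Mapping.lookup s g) y))"
  define L where "L = (\<lambda>h y. \<Sum>g\<in>Poly_Mapping.keys s.
      Poly_Mapping.single (h + g) (?m y (Poly_Mapping.lookup s g)))"
  have R: "tensor_mul (mul A) s t =
      (\<Sum>h\<in>Poly_Mapping.keys t. R h (Poly_Mapping.lookup t h))" for t
    unfolding R_def tensor_mul_def by (rule sum.swap)
  have L: "tensor_mul (mul A) t s =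
      (\<Sum>h\<in>Poly_Mapping.keys t. L h (Poly_Mapping.lookup t h))" for t
    unfolding L_def tensor_mul_def ..
  have *: "linear_on P (\<lambda>t. \<Sum>h\<in>Poly_Mapping.keys t. F h (Poly_Mapping.lookup t h))"
    if F0: "\<And>h. F h 0 = 0"
      and Fadd: "\<And>h y y'. y \<in> ?C \<Longrightarrow> y' \<in> ?C \<Longrightarrow> F h (y + y') = F h y + F h y'"
      and Fscale: "\<And>h r y. y \<in> ?C \<Longrightarrow> F h (r *\<^sub>R y) = r *\<^sub>R F h y"
    for F :: "'c \<Rightarrow> 'a \<times> 'a \<Rightarrow> 'c \<Rightarrow>\<^sub>0 'a \<times> 'a"
    unfolding linear_on_def
  proof (intro conjI ballI allI)
    fix x y assume "x \<in> P" "y \<in> P"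
    then show "(\<Sum>h\<in>Poly_Mapping.keys (x + y). F h (Poly_Mapping.lookup (x + y) h)) =
        (\<Sum>h\<in>Poly_Mapping.keys x. F h (Poly_Mapping.lookup x h)) +
        (\<Sum>h\<in>Poly_Mapping.keys y. F h (Poly_Mapping.lookup y h))"
      by (intro setsum_keys_plus_distrib F0 Fadd P)
  next
    fix r x assume x: "x \<in> P"
    have "(\<Sum>h\<in>Poly_Mapping.keys (r *\<^sub>R x). F h (Poly_Mapping.lookup (r *\<^sub>R x) h)) =
        (\<Sum>h\<in>Poly_Mapping.keys x. F h (Poly_Mapping.lookup (r *\<^sub>R x) h))"
      by (rule sum.mono_neutral_left) (auto simp: lookup_scaleR_poly_mapping in_keys_iff F0)
    then show "(\<Sum>h\<in>Poly_Mapping.keys (r *\<^sub>R x). F h (Poly_Mapping.lookup (r *\<^sub>R x) h)) =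
        r *\<^sub>R (\<Sum>h\<in>Poly_Mapping.keys x. F h (Poly_Mapping.lookup x h))"
      by (simp add: lookup_scaleR_poly_mapping Fscale[OF P[OF x]] scaleR_sum_right)
  qed
  show "linear_on P (\<lambda>t. tensor_mul (mul A) s t)"
    unfolding R
    by (rule *) (simp_all only: R_def m0[OF s'] madd[OF s'] mscale[OF s' _ C0] single_zero
        single_add sum.distrib sum.neutral_const linear_scale[OF linear_single] scaleR_sum_right)
  show "linear_on P (\<lambda>t. tensor_mul (mul A) t s)"
    unfolding L
    by (rule *) (simp_all only: L_def m0[OF s'] madd[OF s'] mscale[OF s' _ C0] single_zero
        single_add sum.distrib sum.neutral_const linear_scale[OF linear_single] scaleR_sum_right)
qed

theorem graded_real_alg_loop_alg:
  fixes \<pi> :: "'g::ab_group_add \<Rightarrow> 'h::ab_group_add"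
    and A :: "('v::real_vector, 'h, 'm) graded_alg_scheme"
  assumes \<pi>: "Modules.additive \<pi>" and \<psi>: "unitary_character \<psi>"
    and norm_z: "\<And>g. cmod (z g) = 1" and z_sq: "\<And>g. (z g)\<^sup>2 = \<psi> g"
    and A: "graded_real_alg A"
  shows "graded_real_alg (loop_alg \<pi> z A)"
proof -
  let ?L = "loop_component \<pi> z A"
  let ?K = "span (\<Union>g. ?L g)"
  let ?u = "\<lambda>g. Poly_Mapping.single g (z g)"
  note lookup = Poly_Mapping.lookup_single
  have alg: "real_alg A"
    and sub: "\<And>g. subspace (homog A g)" "\<And>g. homog A g \<subseteq> carr A"
    and prod: "\<And>g h x y. x \<in> homog A g \<Longrightarrow> y \<in> homog A h \<Longrightarrow> mul A x y \<in> homog A (g + h)"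
    using A unfolding graded_real_alg_def by blast+
  have subL: "subspace (?L g)" for g
    unfolding loop_component_def by (rule linear_subspace_image[OF linear_tensor_left sub(1)])
  have supp: "s = Poly_Mapping.single g (Poly_Mapping.lookup s g)" if "s \<in> ?L g" for s g
    using that by (auto simp: loop_component_def tensor_single)
  have mem: "Poly_Mapping.single g (Poly_Mapping.lookup s g) \<in> ?L g" if "s \<in> ?K" for s g
    using that
  proof (induction rule: span_induct)
    case base
    show ?case
      unfolding subspace_def mem_Collect_eq
      using subL[of g] by (auto simp: lookup_add single_add lookup_scaleR_poly_mapping
          linear_scale[OF linear_single] subspace_0 subspace_add subspace_scale)
  next
    case (step x)
    then obtain h where h: "x \<in> ?L h" by blast
    show ?case
    proof (cases "h = g")
      case True
      then show ?thesis using h supp[OF h] by simp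
    next
      case False
      then have "Poly_Mapping.lookup x g = 0"
        by (subst supp[OF h]) (simp add: lookup when_def)
      then show ?thesis using subspace_0[OF subL] by simp
    qed
  qed
  have prodL: "tensor_mul (mul A) s t \<in> ?L (g + h)" if st: "s \<in> ?L g" "t \<in> ?L h" for s t g h
  proof -
    obtain a b where a: "a \<in> homog A (\<pi> g)" "s = tensor a (?u g)"
      and b: "b \<in> homog A (\<pi> h)" "t = tensor b (?u h)"
      using st unfolding loop_component_def by blast
    have "(z g * z h)\<^sup>2 = (z (g + h))\<^sup>2"
      using \<psi> by (simp add: power_mult_distrib z_sq unitary_character_def)
    then have "z g * z h = z (g + h) \<or> z g * z h = - z (g + h)"
      by (rule power2_eq_iff[THEN iffD1])
    then obtain r :: real where r: "z g * z h = r *\<^sub>R z (g + h)"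
      by (metis scaleR_one scaleR_minus1_left)
    have "tensor_mul (mul A) s t = tensor (mul A a b) (r *\<^sub>R ?u (g + h))"
      using a(1) b(1) sub(2) unfolding a(2) b(2)
      by (subst tensor_mul_tensor[OF alg])
        (auto simp: mult_single r linear_scale[OF linear_single] subset_iff)
    also have "\<dots> = tensor (r *\<^sub>R mul A a b) (?u (g + h))"
      by (simp only: linear_scale[OF linear_tensor_left] linear_scale[OF linear_tensor_right])
    also have "\<dots> \<in> ?L (g + h)"
      using prod[OF a(1) b(1)] sub(1) \<pi>
      by (auto simp: loop_component_def Modules.additive.add subspace_scale)
    finally show ?thesis .
  qed
  have K_carr: "fst (Poly_Mapping.lookup s g) \<in> carr A \<and> snd (Poly_Mapping.lookup s g) \<in> carr A"
    if s: "s \<in> ?K" for s g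
  proof -
    obtain a where a: "a \<in> homog A (\<pi> g)"
      and e: "Poly_Mapping.single g (Poly_Mapping.lookup s g) = tensor a (?u g)"
      using mem[OF s, of g] unfolding loop_component_def by blast
    have "Poly_Mapping.lookup s g = (Re (z g) *\<^sub>R a, Im (z g) *\<^sub>R a)"
      using arg_cong[OF e, of "\<lambda>p. Poly_Mapping.lookup p g"] by (simp add: lookup_tensor)
    moreover have "r *\<^sub>R a \<in> carr A" for r
      using subspace_scale[OF sub(1) a] sub(2) by blast
    ultimately show ?thesis by simp
  qed
  let ?P = "{t. \<forall>h. fst (Poly_Mapping.lookup t h) \<in> carr A \<and> snd (Poly_Mapping.lookup t h) \<in> carr A}"
  have KP: "?K \<subseteq> ?P" using K_carr by blast
  have lin: "linear_on ?K (\<lambda>t. tensor_mul (mul A) s t)" "linear_on ?K (\<lambda>t. tensor_mul (mul A) t s)"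
    if "s \<in> ?K" for s
    using linear_on_tensor_mul[OF alg K_carr[OF that]] KP unfolding linear_on_def by blast+
  have closed_half: "tensor_mul (mul A) s t \<in> ?K" if s: "s \<in> ?L g" and t: "t \<in> ?K" for s t g
  proof -
    have sK: "s \<in> ?K" using s by (auto intro: span_base)
    have "t \<in> ?K \<and> tensor_mul (mul A) s t \<in> ?K"
      using t
    proof (induction rule: span_induct_alt)
      case base
      then show ?case
        using linear_on_0[OF subspace_span lin(1)[OF sK]] by (simp add: span_zero)
    next
      case (step c x y)
      then obtain h where h: "x \<in> ?L h" by blast
      have x: "x \<in> ?K" using step by (auto intro: span_base)
      have "tensor_mul (mul A) s x \<in> ?K" using prodL[OF s h] by (auto intro: span_base)
      then show ?case
        using lin(1)[OF sK] x step unfolding linear_on_def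
        by (simp add: span_add span_scale)
    qed
    then show ?thesis by blast
  qed
  have closed: "tensor_mul (mul A) s t \<in> ?K" if s: "s \<in> ?K" and t: "t \<in> ?K" for s t
  proof -
    have "s \<in> ?K \<and> tensor_mul (mul A) s t \<in> ?K"
      using s
    proof (induction rule: span_induct_alt)
      case base
      then show ?case
        using linear_on_0[OF subspace_span lin(2)[OF t]] by (simp add: span_zero)
    next
      case (step c x y)
      then obtain h where h: "x \<in> ?L h" by blast
      have x: "x \<in> ?K" using step by (auto intro: span_base)
      show ?case
        using lin(2)[OF t] x step closed_half[OF h t] unfolding linear_on_def
        by (simp add: span_add span_scale)
    qed
    then show ?thesis by blast
  qed
  have decomp: "\<exists>!c. homog_decomp (loop_alg \<pi> z A) x c" if x: "x \<in> ?K" for x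
  proof -
    let ?f = "\<lambda>g. Poly_Mapping.single g (Poly_Mapping.lookup x g)"
    have fin: "finite {g. ?f g \<noteq> 0}"
      by (rule finite_subset[OF _ finite_lookup[of x]]) auto
    define c where "c = Abs_poly_mapping ?f"
    have c: "Poly_Mapping.lookup c g = ?f g" for g
      using fin by (simp add: c_def Abs_poly_mapping_inverse)
    have "Poly_Mapping.single g v = 0 \<longleftrightarrow> v = 0" for g :: 'g and v :: "'v \<times> 'v"
      by (metis lookup_single_eq lookup_zero single_zero)
    then have keys_c: "Poly_Mapping.keys c = Poly_Mapping.keys x"
      by (simp add: set_eq_iff in_keys_iff c)
    show ?thesis
    proof (rule ex1I[of _ c])
      show "homog_decomp (loop_alg \<pi> z A) x c"
        using mem[OF x] by (simp add: homog_decomp_def loop_alg_def c keys_c poly_mapping_expansion)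
    next
      fix d assume d: "homog_decomp (loop_alg \<pi> z A) x d"
      then have dL: "Poly_Mapping.lookup d g \<in> ?L g" for g
        by (simp add: homog_decomp_def loop_alg_def)
      have x_eq: "x = (\<Sum>g\<in>Poly_Mapping.keys d. Poly_Mapping.lookup d g)"
        using d by (simp add: homog_decomp_def)
      have off: "Poly_Mapping.lookup (Poly_Mapping.lookup d g) k = 0" if "g \<noteq> k" for g k
        using that by (subst supp[OF dL[of g]]) (simp add: lookup when_def)
      have on: "Poly_Mapping.lookup x k = Poly_Mapping.lookup (Poly_Mapping.lookup d k) k" for k
      proof -
        have "Poly_Mapping.lookup x k =
            (\<Sum>g\<in>Poly_Mapping.keys d. Poly_Mapping.lookup (Poly_Mapping.lookup d g) k)"
          by (subst x_eq) (simp add: lookup_sum)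
        also have "\<dots> = (\<Sum>g\<in>Poly_Mapping.keys d.
            if g = k then Poly_Mapping.lookup (Poly_Mapping.lookup d k) k else 0)"
          by (rule sum.cong[OF refl]) (use off in auto)
        also have "\<dots> = Poly_Mapping.lookup (Poly_Mapping.lookup d k) k"
          by (simp add: in_keys_iff)
        finally show ?thesis .
      qed
      show "d = c"
      proof (rule poly_mapping_eqI)
        fix k
        show "Poly_Mapping.lookup d k = Poly_Mapping.lookup c k"
          unfolding c on by (rule supp[OF dL])
      qed
    qed
  qed
  show ?thesis
    unfolding graded_real_alg_def
  proof (intro conjI)
    show "real_alg (loop_alg \<pi> z A)"
      using closed lin by (simp add: real_alg_def loop_alg_def)
    show "\<forall>g. subspace (homog (loop_alg \<pi> z A) g) \<and>
        homog (loop_alg \<pi> z A) g \<subseteq> carr (loop_alg \<pi> z A)"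
      using subL by (auto simp: loop_alg_def intro: span_base)
    show "\<forall>x\<in>carr (loop_alg \<pi> z A). \<exists>!c. homog_decomp (loop_alg \<pi> z A) x c"
      using decomp by (simp add: loop_alg_def)
    show "\<forall>g h. \<forall>x\<in>homog (loop_alg \<pi> z A) g. \<forall>y\<in>homog (loop_alg \<pi> z A) h.
        mul (loop_alg \<pi> z A) x y \<in> homog (loop_alg \<pi> z A) (g + h)"
      using prodL by (simp add: loop_alg_def)
  qed
qed

end

theory Submission
  imports Defs
begin

text \<open>
  A graded isomorphism of loop algebras amounts to linear bijections \<open>f\<^sub>g\<close> from the component of
  \<open>A\<close> of degree \<open>\<pi> g\<close> to that of \<open>A'\<close> with \<open>f\<^sub>g\<^sub>+\<^sub>h (a b) = f\<^sub>g a f\<^sub>h b\<close>. For \<open>k\<close> in the kernel of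
  \<open>\<pi>\<close> the maps \<open>f\<^sub>g\<inverse> \<circ> f\<^sub>g\<^sub>+\<^sub>k\<close> form an element of the centroid of \<open>A\<close>, hence are multiplication
  by a scalar \<open>\<nu> k\<close>; then \<open>\<nu>\<close> is a character and the maps \<open>f\<^bsub>\<xi> h\<^esub>\<close> identify the twist of \<open>A\<close> by \<open>\<nu>\<close>
  with \<open>A'\<close>. Conversely, an isomorphism \<open>\<theta>\<close> from the twist to \<open>A'\<close> gives the family
  \<open>f\<^sub>g = \<nu> (g - \<xi> (\<pi> g)) \<theta>\<close>.
\<close>

section \<open>Linear maps on subspaces\<close>

lemma linear_on_subset: "linear_on V f \<Longrightarrow> W \<subseteq> V \<Longrightarrow> linear_on W f"
  unfolding linear_on_def by blast

lemma linear_on_compose: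
  "linear_on V f \<Longrightarrow> linear_on W g \<Longrightarrow> f ` V \<subseteq> W \<Longrightarrow> linear_on V (\<lambda>x. g (f x))"
  unfolding linear_on_def by (simp add: image_subset_iff)

lemma linear_on_inv_into:
  assumes "subspace V" "linear_on V f" "bij_betw f V W"
  shows "linear_on W (inv_into V f)"
proof -
  have inv: "inv_into V f y \<in> V" "f (inv_into V f y) = y" if "y \<in> W" for y
    using assms(3) that by (auto simp: bij_betw_def inv_into_into f_inv_into_f)
  have inj: "inv_into V f (f x) = x" if "x \<in> V" for x
    using assms(3) that by (auto simp: bij_betw_def)
  show ?thesis
    unfolding linear_on_def
  proof (intro conjI ballI allI)
    fix x y assume "x \<in> W" "y \<in> W"
    then show "inv_into V f (x + y) = inv_into V f x + inv_into V f y"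
      using inj[of "inv_into V f x + inv_into V f y"] assms(1,2) inv
      by (simp add: linear_on_def subspace_add)
  next
    fix r x assume "x \<in> W"
    then show "inv_into V f (r *\<^sub>R x) = r *\<^sub>R inv_into V f x"
      using inj[of "r *\<^sub>R inv_into V f x"] assms(1,2) inv
      by (simp add: linear_on_def subspace_scale)
  qed
qed

section \<open>Homogeneous decompositions and extension from components\<close>

lemma real_algD:
  assumes "real_alg A"
  shows "subspace (carr A)"
    and "\<lbrakk>x \<in> carr A; y \<in> carr A\<rbrakk> \<Longrightarrow> mul A x y \<in> carr A"
    and "\<lbrakk>x \<in> carr A; y \<in> carr A; w \<in> carr A\<rbrakk> \<Longrightarrow> mul A x (y + w) = mul A x y + mul A x w"
    and "\<lbrakk>x \<in> carr A; y \<in> carr A; w \<in> carr A\<rbrakk> \<Longrightarrow> mul A (x + w) y = mul A x y + mul A w y"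
    and "\<lbrakk>x \<in> carr A; y \<in> carr A\<rbrakk> \<Longrightarrow> mul A x (r *\<^sub>R y) = r *\<^sub>R mul A x y"
    and "\<lbrakk>x \<in> carr A; y \<in> carr A\<rbrakk> \<Longrightarrow> mul A (r *\<^sub>R x) y = r *\<^sub>R mul A x y"
  using assms unfolding real_alg_def linear_on_def by blast+

lemma graded_real_algD:
  assumes "graded_real_alg A"
  shows "real_alg A"
    and "subspace (homog A g)"
    and "x \<in> homog A g \<Longrightarrow> x \<in> carr A"
    and "\<lbrakk>x \<in> homog A g; y \<in> homog A h\<rbrakk> \<Longrightarrow> mul A x y \<in> homog A (g + h)"
  using assms unfolding graded_real_alg_def by blast+

lemma homog_decomp_homog_parts:
  assumes "graded_real_alg A" "x \<in> carr A"
  shows "homog_decomp A x (homog_parts A x)"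
  using assms unfolding graded_real_alg_def homog_parts_def by (blast intro: theI')

lemma homog_parts_eqI:
  assumes "graded_real_alg A" "x \<in> carr A" "homog_decomp A x c"
  shows "homog_parts A x = c"
  using assms homog_decomp_homog_parts[OF assms(1,2)] unfolding graded_real_alg_def by blast

lemma lookup_homog_parts:
  assumes "graded_real_alg A" "x \<in> carr A"
  shows "Poly_Mapping.lookup (homog_parts A x) g \<in> homog A g"
  using homog_decomp_homog_parts[OF assms] by (simp add: homog_decomp_def)

text \<open>Adding decompositions of \<open>x\<close> and \<open>y\<close> yields a decomposition of
  \<open>x + y\<close>, and decompositions are unique.\<close>

lemma homog_parts_add:
  assumes A: "graded_real_alg A" and x: "x \<in> carr A" and y: "y \<in> carr A"
  shows "homog_parts A (x + y) = homog_parts A x + homog_parts A y"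
proof (rule homog_parts_eqI[OF A])
  show "x + y \<in> carr A"
    using graded_real_algD(1)[OF A] x y by (simp add: real_algD(1) subspace_add)
  have "(\<Sum>g\<in>Poly_Mapping.keys (homog_parts A x + homog_parts A y).
      Poly_Mapping.lookup (homog_parts A x + homog_parts A y) g) = x + y"
    using homog_decomp_homog_parts[OF A x] homog_decomp_homog_parts[OF A y]
    by (subst setsum_keys_plus_distrib) (simp_all add: homog_decomp_def)
  then show "homog_decomp A (x + y) (homog_parts A x + homog_parts A y)"
    using lookup_homog_parts[OF A x] lookup_homog_parts[OF A y] graded_real_algD(2)[OF A]
    by (simp add: homog_decomp_def lookup_add subspace_add)
qed

lemma homog_parts_scaleR:
  assumes A: "graded_real_alg A" and x: "x \<in> carr A"
  shows "homog_parts A (r *\<^sub>R x) = r *\<^sub>R homog_parts A x"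
proof (rule homog_parts_eqI[OF A])
  let ?c = "homog_parts A x"
  show "r *\<^sub>R x \<in> carr A"
    using graded_real_algD(1)[OF A] x by (simp add: real_algD(1) subspace_scale)
  have "(\<Sum>g\<in>Poly_Mapping.keys (r *\<^sub>R ?c). Poly_Mapping.lookup (r *\<^sub>R ?c) g) =
      r *\<^sub>R (\<Sum>g\<in>Poly_Mapping.keys ?c. Poly_Mapping.lookup ?c g)"
    using linear_scale[OF linear_poly_mapping_sum[of "\<lambda>g x. x"]] by (simp add: linear_id[unfolded id_def])
  then show "homog_decomp A (r *\<^sub>R x) (r *\<^sub>R ?c)"
    using homog_decomp_homog_parts[OF A x] graded_real_algD(2)[OF A]
    by (simp add: homog_decomp_def lookup_scaleR_poly_mapping subspace_scale)
qed

text \<open>Every element is a finite sum of homogeneous ones, and the components already absorb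
  scalars, so only sums have to be treated. This is how identities pass from components to the whole
  algebra.\<close>

lemma graded_induct [consumes 2, case_names homog add]:
  assumes A: "graded_real_alg A" and x: "x \<in> carr A"
    and homog: "\<And>g x. x \<in> homog A g \<Longrightarrow> P x"
    and add: "\<And>x y. \<lbrakk>x \<in> carr A; y \<in> carr A; P x; P y\<rbrakk> \<Longrightarrow> P (x + y)"
  shows "P x"
proof -
  let ?c = "homog_parts A x"
  \<comment> \<open>Partial sums over arbitrary finite sets make the induction possible; membership
    in the carrier is carried along because the sum case demands it.\<close>
  have "(\<Sum>g\<in>S. Poly_Mapping.lookup ?c g) \<in> carr A \<and> P (\<Sum>g\<in>S. Poly_Mapping.lookup ?c g)"
    if "finite S" for S
    using that
  proof induction
    case empty
    \<comment> \<open>The empty sum is 0, which is homogeneous of every degree;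
      \<open>undefined\<close> merely names one.\<close>
    have "0 \<in> homog A undefined" using graded_real_algD(2)[OF A] by (rule subspace_0)
    then show ?case using homog graded_real_algD(3)[OF A] by (metis sum.empty)
  next
    case (insert g S)
    have "Poly_Mapping.lookup ?c g \<in> homog A g" by (rule lookup_homog_parts[OF A x])
    then show ?case
      using insert homog add graded_real_algD(3)[OF A] real_algD(1)[OF graded_real_algD(1)[OF A]]
      by (simp add: subspace_add)
  qed
  then show ?thesis
    using homog_decomp_homog_parts[OF A x] by (metis homog_decomp_def finite_keys)
qed

text \<open>The common extension of maps given on the components to their direct sum. It later
  produces the twisted product, graded isomorphisms and an element of the centroid.\<close>

definition homog_extend ::
  "('v::real_vector, 'g, 'm) graded_alg_scheme \<Rightarrow> ('g \<Rightarrow> 'v \<Rightarrow> 'w::real_vector) \<Rightarrow> 'v \<Rightarrow> 'w" where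
  "homog_extend A F x = (\<Sum>g\<in>Poly_Mapping.keys (homog_parts A x).
     F g (Poly_Mapping.lookup (homog_parts A x) g))"

lemma homog_extend_homog:
  assumes A: "graded_real_alg A" and F: "linear_on (homog A g) (F g)" and x: "x \<in> homog A g"
  shows "homog_extend A F x = F g x"
  using linear_on_0[OF graded_real_algD(2)[OF A] F]
  by (simp add: homog_extend_def homog_parts_homogeneous[OF A x])

lemma linear_on_homog_extend:
  assumes A: "graded_real_alg A" and F: "\<And>g. linear_on (homog A g) (F g)"
  shows "linear_on (carr A) (homog_extend A F)"
proof -
  note F0 = linear_on_0[OF graded_real_algD(2)[OF A] F]
  show ?thesis
    unfolding linear_on_def
  proof (intro conjI ballI allI)
    fix x y assume x: "x \<in> carr A" and y: "y \<in> carr A"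
    show "homog_extend A F (x + y) = homog_extend A F x + homog_extend A F y"
      unfolding homog_extend_def homog_parts_add[OF A x y]
    proof -
      let ?S = "Poly_Mapping.keys (homog_parts A x) \<union> Poly_Mapping.keys (homog_parts A y)"
      \<comment> \<open>All three sums are brought to one index set, the added terms being
        \<open>F g 0 = 0\<close>. Additivity of \<open>F g\<close> is then applied only to elements
        of the component of degree g.\<close>
      have *: "(\<Sum>g\<in>Poly_Mapping.keys c. F g (Poly_Mapping.lookup c g)) =
          (\<Sum>g\<in>?S. F g (Poly_Mapping.lookup c g))" if "Poly_Mapping.keys c \<subseteq> ?S" for c
        by (rule sum.mono_neutral_left) (use that F0 in \<open>auto simp: in_keys_iff\<close>)
      show "(\<Sum>g\<in>Poly_Mapping.keys (homog_parts A x + homog_parts A y).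
            F g (Poly_Mapping.lookup (homog_parts A x + homog_parts A y) g)) =
          (\<Sum>g\<in>Poly_Mapping.keys (homog_parts A x). F g (Poly_Mapping.lookup (homog_parts A x) g)) +
          (\<Sum>g\<in>Poly_Mapping.keys (homog_parts A y). F g (Poly_Mapping.lookup (homog_parts A y) g))"
        unfolding *[OF Poly_Mapping.keys_add] *[OF Un_upper1] *[OF Un_upper2] sum.distrib[symmetric]
        using F lookup_homog_parts[OF A x] lookup_homog_parts[OF A y]
        by (simp add: lookup_add linear_on_def)
    qed
  next
    fix r x assume x: "x \<in> carr A"
    let ?c = "homog_parts A x"
    have "(\<Sum>g\<in>Poly_Mapping.keys (r *\<^sub>R ?c). F g (Poly_Mapping.lookup (r *\<^sub>R ?c) g)) =
        (\<Sum>g\<in>Poly_Mapping.keys ?c. F g (Poly_Mapping.lookup (r *\<^sub>R ?c) g))"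
      by (rule sum.mono_neutral_left) (auto simp: lookup_scaleR_poly_mapping in_keys_iff F0)
    then show "homog_extend A F (r *\<^sub>R x) = r *\<^sub>R homog_extend A F x"
      using F lookup_homog_parts[OF A x]
      by (simp add: homog_extend_def homog_parts_scaleR[OF A x] lookup_scaleR_poly_mapping
          linear_on_def scaleR_sum_right)
  qed
qed

section \<open>Families of isomorphisms between components\<close>

text \<open>The index runs over G, not its quotient: \<open>f g\<close> and \<open>f h\<close> may
  differ although \<open>\<pi> g = \<pi> h\<close>, and this difference carries the character of the
  kernel. With the identity for \<pi> the notion describes ordinary graded isomorphisms.\<close>

definition component_isos ::
  "('g::ab_group_add \<Rightarrow> 'h) \<Rightarrow> ('v::real_vector, 'h, 'm) graded_alg_scheme \<Rightarrow>
   ('w::real_vector, 'h, 'n) graded_alg_scheme \<Rightarrow> ('g \<Rightarrow> 'v \<Rightarrow> 'w) \<Rightarrow> bool" where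
  "component_isos \<pi> A B f \<longleftrightarrow>
     (\<forall>g. bij_betw (f g) (homog A (\<pi> g)) (homog B (\<pi> g)) \<and> linear_on (homog A (\<pi> g)) (f g)) \<and>
     (\<forall>g h. \<forall>x\<in>homog A (\<pi> g). \<forall>y\<in>homog A (\<pi> h).
        f (g + h) (mul A x y) = mul B (f g x) (f h y))"

lemma component_isosD:
  assumes "component_isos \<pi> A B f"
  shows "bij_betw (f g) (homog A (\<pi> g)) (homog B (\<pi> g))"
    and "linear_on (homog A (\<pi> g)) (f g)"
    and "\<lbrakk>x \<in> homog A (\<pi> g); y \<in> homog A (\<pi> h)\<rbrakk> \<Longrightarrow>
      f (g + h) (mul A x y) = mul B (f g x) (f h y)"
  using assms unfolding component_isos_def by blast+

text \<open>Multiplicativity is checked after applying the injective map \<open>f (g + h)\<close>.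
  The lemma serves to reverse the direction of an isomorphism.\<close>

lemma component_isos_inv_into:
  assumes \<pi>: "Modules.additive \<pi>" and A: "graded_real_alg A" and f: "component_isos \<pi> A B f"
  shows "component_isos \<pi> B A (\<lambda>g. inv_into (homog A (\<pi> g)) (f g))"
  unfolding component_isos_def
proof (intro conjI allI ballI)
  fix g
  show "bij_betw (inv_into (homog A (\<pi> g)) (f g)) (homog B (\<pi> g)) (homog A (\<pi> g))"
    using component_isosD(1)[OF f] by (rule bij_betw_inv_into)
  show "linear_on (homog B (\<pi> g)) (inv_into (homog A (\<pi> g)) (f g))"
    by (rule linear_on_inv_into[OF graded_real_algD(2)[OF A] component_isosD(2,1)[OF f]])
next
  fix g h x y assume x: "x \<in> homog B (\<pi> g)" and y: "y \<in> homog B (\<pi> h)"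
  let ?x = "inv_into (homog A (\<pi> g)) (f g) x" and ?y = "inv_into (homog A (\<pi> h)) (f h) y"
  have inv: "inv_into (homog A (\<pi> g)) (f g) x \<in> homog A (\<pi> g)"
      "f g (inv_into (homog A (\<pi> g)) (f g) x) = x"
    if "x \<in> homog B (\<pi> g)" for g x
    using component_isosD(1)[OF f, of g] that
    by (auto simp: bij_betw_def inv_into_into f_inv_into_f)
  have "f (g + h) (mul A ?x ?y) = mul B x y"
    using component_isosD(3)[OF f] inv x y by simp
  moreover have "mul A ?x ?y \<in> homog A (\<pi> (g + h))"
    using graded_real_algD(4)[OF A] inv x y \<pi> by (simp add: Modules.additive.add)
  ultimately show "inv_into (homog A (\<pi> (g + h))) (f (g + h)) (mul B x y) = mul A ?x ?y"
    using component_isosD(1)[OF f, of "g + h"] by (metis bij_betw_def inv_into_f_f)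
qed

text \<open>A graded isomorphism restricts to the components; conversely, the extensions of a family
  and of its inverse family are inverse to each other.\<close>

lemma graded_isomorphic_iff_component_isos:
  assumes A: "graded_real_alg A" and B: "graded_real_alg B"
  shows "graded_isomorphic A B \<longleftrightarrow> (\<exists>f. component_isos (\<lambda>g. g) A B f)"
proof
  assume "graded_isomorphic A B"
  then obtain f where f: "bij_betw f (carr A) (carr B)" "linear_on (carr A) f"
    "\<forall>x\<in>carr A. \<forall>y\<in>carr A. f (mul A x y) = mul B (f x) (f y)"
    "\<forall>g. f ` homog A g = homog B g"
    unfolding graded_isomorphic_def by blast
  have sub: "homog A g \<subseteq> carr A" for g using graded_real_algD(3)[OF A] by blast
  have "component_isos (\<lambda>g. g) A B (\<lambda>g. f)"
    unfolding component_isos_def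
    using f sub bij_betw_subset[OF f(1) sub] linear_on_subset[OF f(2) sub]
    by (auto simp: subset_iff)
  then show "\<exists>f. component_isos (\<lambda>g. g) A B f" by blast
next
  assume "\<exists>f. component_isos (\<lambda>g. g) A B f"
  then obtain f where f: "component_isos (\<lambda>g. g) A B f" by blast
  define f' where "f' = (\<lambda>g. inv_into (homog A g) (f g))"
  have f': "component_isos (\<lambda>g. g) B A f'"
    unfolding f'_def using component_isos_inv_into[OF _ A f]
    by (simp add: Modules.additive_def)
  let ?F = "homog_extend A f" and ?G = "homog_extend B f'"
  note linF = linear_on_homog_extend[OF A component_isosD(2)[OF f]]
    and linG = linear_on_homog_extend[OF B component_isosD(2)[OF f']]
  note F = homog_extend_homog[where F = f, OF A component_isosD(2)[OF f]]
    and G = homog_extend_homog[where F = f', OF B component_isosD(2)[OF f']]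
  note alg = graded_real_algD(1)[OF A] graded_real_algD(1)[OF B]
  have im: "f g x \<in> homog B g" if "x \<in> homog A g" for g x
    using component_isosD(1)[OF f] that by (auto simp: bij_betw_def)
  have im': "f' g x \<in> homog A g" if "x \<in> homog B g" for g x
    using component_isosD(1)[OF f'] that by (auto simp: bij_betw_def)
  have inv: "f' g (f g x) = x" if "x \<in> homog A g" for g x
    using component_isosD(1)[OF f, of g] that by (simp add: f'_def bij_betw_def)
  have inv': "f g (f' g x) = x" if "x \<in> homog B g" for g x
    using component_isosD(1)[OF f, of g] that by (simp add: f'_def bij_betw_def f_inv_into_f)
  have FB: "?F x \<in> carr B" and GF: "?G (?F x) = x" if "x \<in> carr A" for x
  proof -
    \<comment> \<open>Both claims go through one induction: additivity of \<open>?G\<close> at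
      \<open>?F x + ?F y\<close> requires these values to lie in \<open>carr B\<close>.\<close>
    have "?F x \<in> carr B \<and> ?G (?F x) = x"
      using A that
    proof (induction rule: graded_induct)
      case (homog g x)
      then show ?case
        using graded_real_algD(3)[OF B im[OF homog]] F[OF homog] G[OF im[OF homog]] inv[OF homog]
        by simp
    next
      case (add x y)
      then show ?case
        using linF linG real_algD(1)[OF alg(2)] by (simp add: linear_on_def subspace_add)
    qed
    then show "?F x \<in> carr B" "?G (?F x) = x" by auto
  qed
  have GA: "?G x \<in> carr A" and FG: "?F (?G x) = x" if "x \<in> carr B" for x
  proof -
    have "?G x \<in> carr A \<and> ?F (?G x) = x"
      using B that
    proof (induction rule: graded_induct)
      case (homog g x)
      then show ?case
        using graded_real_algD(3)[OF A im'[OF homog]] G[OF homog] F[OF im'[OF homog]] inv'[OF homog]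
        by simp
    next
      case (add x y)
      then show ?case
        using linF linG real_algD(1)[OF alg(1)] by (simp add: linear_on_def subspace_add)
    qed
    then show "?G x \<in> carr A" "?F (?G x) = x" by auto
  qed
  \<comment> \<open>Bilinearity allows one factor at a time: first the right factor is made general,
    then the left.\<close>
  have mult_homog: "?F (mul A x y) = mul B (?F x) (?F y)"
    if x: "x \<in> homog A g" and y: "y \<in> carr A" for g x y
    using A y
  proof (induction rule: graded_induct)
    case (homog h y)
    then show ?case
      using F[OF graded_real_algD(4)[OF A x homog]] F[OF x] F[OF homog] component_isosD(3)[OF f x homog]
      by simp
  next
    case (add y w)
    have "x \<in> carr A" using graded_real_algD(3)[OF A x] .
    then show ?case
      using add linF FB alg by (simp add: linear_on_def real_algD)
  qed
  have mult: "?F (mul A x y) = mul B (?F x) (?F y)" if x: "x \<in> carr A" and y: "y \<in> carr A" for x y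
    using A x
  proof (induction rule: graded_induct)
    case (homog g x)
    then show ?case using mult_homog y by blast
  next
    case (add x w)
    then show ?case
      using y linF FB alg by (simp add: linear_on_def real_algD)
  qed
  have "?F ` homog A g = homog B g" for g
    using component_isosD(1)[OF f, of g] by (simp add: F bij_betw_def cong: image_cong)
  moreover have "bij_betw ?F (carr A) (carr B)"
    by (rule bij_betw_byWitness[of _ ?G]) (use FB GF GA FG in auto)
  ultimately show "graded_isomorphic A B"
    unfolding graded_isomorphic_def using linF mult by blast
qed

section \<open>Twists as graded algebras\<close>

text \<open>With one argument fixed, the twisted product is a \<open>homog_extend\<close> in the
  other, hence linear there; interchanging the two sums gives both views.\<close>

lemma graded_real_alg_twist:
  assumes A: "graded_real_alg A"
  shows "graded_real_alg (twist \<xi> \<nu> A)"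
proof -
  let ?M = "mul (twist \<xi> \<nu> A)"
  let ?p = "\<lambda>x. Poly_Mapping.lookup (homog_parts A x)"
  let ?F = "\<lambda>y g u. \<Sum>h\<in>Poly_Mapping.keys (homog_parts A y).
    \<nu> (section_cocycle \<xi> g h) *\<^sub>R mul A u (?p y h)"
  let ?G = "\<lambda>x h u. \<Sum>g\<in>Poly_Mapping.keys (homog_parts A x).
    \<nu> (section_cocycle \<xi> g h) *\<^sub>R mul A (?p x g) u"
  note alg = graded_real_algD(1)[OF A]
  have mulF: "?M x y = homog_extend A (?F y) x" for x y
    by (simp add: twist_def homog_extend_def)
  have mulG: "?M x y = homog_extend A (?G x) y" for x y
    unfolding twist_def homog_extend_def by simp (rule sum.swap)
  have p: "?p x g \<in> carr A" if "x \<in> carr A" for x g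
    using graded_real_algD(3)[OF A lookup_homog_parts[OF A that]] .
  have linF: "linear_on (homog A g) (?F y g)" and linG: "linear_on (homog A g) (?G y g)"
    if "y \<in> carr A" for y g
    using p[OF that] alg graded_real_algD(3)[OF A]
    by (simp_all add: linear_on_def real_algD scaleR_add_right sum.distrib scaleR_sum_right
        mult.commute)
  have lin: "linear_on (carr A) (\<lambda>x. ?M x y)" "linear_on (carr A) (\<lambda>x. ?M y x)"
    if "y \<in> carr A" for y
    using linear_on_homog_extend[OF A linF[OF that]] linear_on_homog_extend[OF A linG[OF that]]
    by (simp_all add: mulF[of _ y] mulG[of y])
  have closed: "?M x y \<in> carr A" if "x \<in> carr A" "y \<in> carr A" for x y
    using p[OF that(1)] p[OF that(2)] real_algD(1,2)[OF alg]
    by (simp add: twist_def subspace_sum subspace_scale)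
  have homog: "?M x y \<in> homog A (g + h)" if "x \<in> homog A g" "y \<in> homog A h" for x y g h
    using twist_mul_homogeneous[OF A that, of \<xi> \<nu>] graded_real_algD(4)[OF A that]
      graded_real_algD(2)[OF A, of "g + h"]
    by (simp add: subspace_scale)
  have [simp]: "carr (twist \<xi> \<nu> A) = carr A" "homog (twist \<xi> \<nu> A) = homog A"
    by (simp_all add: twist_def)
  have "homog_decomp (twist \<xi> \<nu> A) = homog_decomp A"
    by (simp add: homog_decomp_def fun_eq_iff)
  then show ?thesis
    using A lin closed homog unfolding graded_real_alg_def real_alg_def by simp
qed

section \<open>Loop algebras\<close>

lemma loop_alg_simps [simp]:
  "mul (loop_alg \<pi> z A) = tensor_mul (mul A)"
  "homog (loop_alg \<pi> z A) = loop_component \<pi> z A"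
  by (simp_all add: loop_alg_def)

text \<open>A nonzero complex number has a nonzero real or imaginary part, and the corresponding
  coordinate determines \<open>a\<close>.\<close>

lemma inj_tensor_single: "c \<noteq> 0 \<Longrightarrow> inj (\<lambda>a. tensor a (Poly_Mapping.single g c))"
  by (rule injI)
    (metis complex_eq_iff lookup_single_eq lookup_tensor prod.inject scaleR_left_imp_eq
      zero_complex.simps)

text \<open>Both \<open>z g * z h\<close> and \<open>z (g + h)\<close> are square roots of \<open>\<psi> (g + h)\<close>, so \<open>\<epsilon>\<close> is a sign.
  It does not depend on the algebra and therefore cancels when two loop algebras are compared.\<close>

lemma tensor_mul_single_square_root:
  assumes \<psi>: "unitary_character \<psi>" and z_sq: "\<And>g. (z g)\<^sup>2 = \<psi> g"
  shows "\<exists>\<epsilon>::real. \<epsilon> \<noteq> 0 \<and> Poly_Mapping.single g (z g) * Poly_Mapping.single h (z h) =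
    \<epsilon> *\<^sub>R Poly_Mapping.single (g + h) (z (g + h))"
proof -
  have "(z g * z h)\<^sup>2 = (z (g + h))\<^sup>2"
    using \<psi> by (simp add: power_mult_distrib z_sq unitary_character_def)
  then have "z g * z h = 1 *\<^sub>R z (g + h) \<or> z g * z h = (- 1) *\<^sub>R z (g + h)"
    by (simp add: power2_eq_iff)
  then obtain \<epsilon> :: real where "\<epsilon> \<noteq> 0" "z g * z h = \<epsilon> *\<^sub>R z (g + h)"
    by (metis zero_neq_neg_one zero_neq_one)
  then show ?thesis
    by (auto simp: mult_single linear_scale[OF linear_single])
qed

text \<open>Moves a real factor of the product in the group algebra over to the algebra factor of
  the tensor.\<close>

lemma tensor_mul_scaleR:
  assumes "real_alg A" "a \<in> carr A" "b \<in> carr A" "p * q = r *\<^sub>R w"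
  shows "tensor_mul (mul A) (tensor a p) (tensor b q) = tensor (r *\<^sub>R mul A a b) w"
  using assms by (simp add: tensor_mul_tensor linear_scale[OF linear_tensor_left]
      linear_scale[OF linear_tensor_right])

text \<open>The map \<open>a \<mapsto> tensor a (single g (z g))\<close> identifies the component of
  degree \<open>\<pi> g\<close> with that of the loop algebra of degree g. Families are transported
  along these identifications, in both directions.\<close>

lemma loop_alg_isomorphic_iff_component_isos:
  fixes A :: "('v::real_vector, 'h::ab_group_add, 'm) graded_alg_scheme"
    and A' :: "('w::real_vector, 'h, 'n) graded_alg_scheme"
    and \<pi> :: "'g::ab_group_add \<Rightarrow> 'h"
  assumes \<pi>: "Modules.additive \<pi>" and \<psi>: "unitary_character \<psi>"
    and norm_z: "\<And>g. cmod (z g) = 1" and z_sq: "\<And>g. (z g)\<^sup>2 = \<psi> g"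
    and A: "graded_real_alg A" and A': "graded_real_alg A'"
  shows "graded_isomorphic (loop_alg \<pi> z A) (loop_alg \<pi> z A') \<longleftrightarrow>
    (\<exists>f. component_isos \<pi> A A' f)"
proof -
  let ?L = "loop_alg \<pi> z A" and ?L' = "loop_alg \<pi> z A'"
  let ?u = "\<lambda>g. Poly_Mapping.single g (z g)"
  let ?I = "\<lambda>g a. tensor a (?u g) :: 'g \<Rightarrow>\<^sub>0 'v \<times> 'v"
  let ?I' = "\<lambda>g a. tensor a (?u g) :: 'g \<Rightarrow>\<^sub>0 'w \<times> 'w"
  have z0: "z g \<noteq> 0" for g using norm_z[of g] by auto
  have \<pi>_add: "\<pi> (g + h) = \<pi> g + \<pi> h" for g h using \<pi> by (simp add: Modules.additive.add)
  note D = graded_real_algD[OF A] and D' = graded_real_algD[OF A']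
  have I: "bij_betw (?I g) (homog A (\<pi> g)) (homog ?L g)" for g
    using inj_on_subset[OF inj_tensor_single[OF z0]] by (auto simp: bij_betw_def loop_component_def)
  have I': "bij_betw (?I' g) (homog A' (\<pi> g)) (homog ?L' g)" for g
    using inj_on_subset[OF inj_tensor_single[OF z0]] by (auto simp: bij_betw_def loop_component_def)
  have linI: "linear_on (homog A (\<pi> g)) (?I g)" and linI': "linear_on (homog A' (\<pi> g)) (?I' g)" for g
    by (simp_all add: linear_on_def linear_add[OF linear_tensor_left] linear_scale[OF linear_tensor_left])
  define J where "J = (\<lambda>g. inv_into (homog A (\<pi> g)) (?I g))"
  define J' where "J' = (\<lambda>g. inv_into (homog A' (\<pi> g)) (?I' g))"
  have J: "bij_betw (J g) (homog ?L g) (homog A (\<pi> g))" "linear_on (homog ?L g) (J g)" for g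
    unfolding J_def using bij_betw_inv_into[OF I] linear_on_inv_into[OF D(2) linI I] by blast+
  have J': "bij_betw (J' g) (homog ?L' g) (homog A' (\<pi> g))" "linear_on (homog ?L' g) (J' g)" for g
    unfolding J'_def using bij_betw_inv_into[OF I'] linear_on_inv_into[OF D'(2) linI' I'] by blast+
  have JI: "J g (?I g a) = a" if "a \<in> homog A (\<pi> g)" for g a
    unfolding J_def using bij_betw_inv_into_left[OF I that] .
  have J'I': "J' g (?I' g a) = a" if "a \<in> homog A' (\<pi> g)" for g a
    unfolding J'_def using bij_betw_inv_into_left[OF I' that] .
  have I'J': "?I' g (J' g s) = s" if "s \<in> homog ?L' g" for g s
    unfolding J'_def using bij_betw_inv_into_right[OF I' that] .
  \<comment> \<open>One \<epsilon> serves both algebras, since it depends only on the product of the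
    two group algebra elements.\<close>
  have mulI: "\<exists>\<epsilon>. \<epsilon> \<noteq> 0 \<and>
      (\<forall>a\<in>homog A (\<pi> g). \<forall>b\<in>homog A (\<pi> h).
        tensor_mul (mul A) (?I g a) (?I h b) = ?I (g + h) (\<epsilon> *\<^sub>R mul A a b)) \<and>
      (\<forall>a\<in>homog A' (\<pi> g). \<forall>b\<in>homog A' (\<pi> h).
        tensor_mul (mul A') (?I' g a) (?I' h b) = ?I' (g + h) (\<epsilon> *\<^sub>R mul A' a b))" for g h
  proof -
    obtain \<epsilon> :: real where \<epsilon>: "\<epsilon> \<noteq> 0" "?u g * ?u h = \<epsilon> *\<^sub>R ?u (g + h)"
      using tensor_mul_single_square_root[OF \<psi> z_sq, of g h] by blast
    show ?thesis
      using \<epsilon>(1) tensor_mul_scaleR[OF D(1) D(3) D(3) \<epsilon>(2)]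
        tensor_mul_scaleR[OF D'(1) D'(3) D'(3) \<epsilon>(2)] by blast
  qed
  have mulA: "mul A a b \<in> homog A (\<pi> (g + h))" if "a \<in> homog A (\<pi> g)" "b \<in> homog A (\<pi> h)" for a b g h
    using D(4)[OF that] by (simp add: \<pi>_add)
  have "(\<exists>f. component_isos (\<lambda>g. g) ?L ?L' f) \<longleftrightarrow> (\<exists>f. component_isos \<pi> A A' f)"
  proof
    assume "\<exists>f. component_isos (\<lambda>g. g) ?L ?L' f"
    then obtain f where f: "component_isos (\<lambda>g. g) ?L ?L' f" by blast
    have IL: "?I g a \<in> homog ?L g" if "a \<in> homog A (\<pi> g)" for g a
      using bij_betwE[OF I] that by blast
    have fL: "f g s \<in> homog ?L' g" if "s \<in> homog ?L g" for g s
      using bij_betwE[OF component_isosD(1)[OF f]] that by blast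
    have "component_isos \<pi> A A' (\<lambda>g a. J' g (f g (?I g a)))"
      unfolding component_isos_def
    proof (intro conjI allI ballI)
      fix g
      show "bij_betw (\<lambda>a. J' g (f g (?I g a))) (homog A (\<pi> g)) (homog A' (\<pi> g))"
        using bij_betw_trans[OF bij_betw_trans[OF I component_isosD(1)[OF f]] J'(1)]
        by (simp add: comp_def)
      show "linear_on (homog A (\<pi> g)) (\<lambda>a. J' g (f g (?I g a)))"
        by (rule linear_on_compose[OF linear_on_compose[OF linI component_isosD(2)[OF f]] J'(2)])
          (use IL fL in auto)
    next
      fix g h a b assume a: "a \<in> homog A (\<pi> g)" and b: "b \<in> homog A (\<pi> h)"
      let ?a = "J' g (f g (?I g a))" and ?b = "J' h (f h (?I h b))"
      have a': "?a \<in> homog A' (\<pi> g)" "?I' g ?a = f g (?I g a)"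
        using bij_betwE[OF J'(1)] I'J' fL IL a by blast+
      have b': "?b \<in> homog A' (\<pi> h)" "?I' h ?b = f h (?I h b)"
        using bij_betwE[OF J'(1)] I'J' fL IL b by blast+
      obtain \<epsilon> where \<epsilon>: "\<epsilon> \<noteq> 0"
        "tensor_mul (mul A) (?I g a) (?I h b) = ?I (g + h) (\<epsilon> *\<^sub>R mul A a b)"
        "tensor_mul (mul A') (?I' g ?a) (?I' h ?b) = ?I' (g + h) (\<epsilon> *\<^sub>R mul A' ?a ?b)"
        using mulI[of g h] a b a'(1) b'(1) by blast
      \<comment> \<open>Linearity of \<open>f (g + h)\<close> brings \<epsilon> out on the left; it
        also comes out of the product in the second loop algebra and, being nonzero,
        cancels.\<close>
      have "\<epsilon> *\<^sub>R f (g + h) (?I (g + h) (mul A a b)) = f (g + h) (?I (g + h) (\<epsilon> *\<^sub>R mul A a b))"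
        using component_isosD(2)[OF f, of "g + h"] IL[OF mulA[OF a b]]
        by (simp add: linear_on_def linear_scale[OF linear_tensor_left])
      also have "\<dots> = tensor_mul (mul A') (f g (?I g a)) (f h (?I h b))"
        using component_isosD(3)[OF f] IL[OF a] IL[OF b] by (simp flip: \<epsilon>(2))
      also have "\<dots> = \<epsilon> *\<^sub>R ?I' (g + h) (mul A' ?a ?b)"
        using \<epsilon>(3) by (simp add: a'(2) b'(2) linear_scale[OF linear_tensor_left])
      finally have "f (g + h) (?I (g + h) (mul A a b)) = ?I' (g + h) (mul A' ?a ?b)"
        using \<epsilon>(1) by simp
      moreover have "J' (g + h) (?I' (g + h) (mul A' ?a ?b)) = mul A' ?a ?b"
        using D'(4)[OF a'(1) b'(1)] by (intro J'I') (simp add: \<pi>_add)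
      ultimately show "J' (g + h) (f (g + h) (?I (g + h) (mul A a b))) = mul A' ?a ?b"
        by simp
    qed
    then show "\<exists>f. component_isos \<pi> A A' f" by blast
  next
    assume "\<exists>f. component_isos \<pi> A A' f"
    then obtain f where f: "component_isos \<pi> A A' f" by blast
    have fA: "f g a \<in> homog A' (\<pi> g)" if "a \<in> homog A (\<pi> g)" for g a
      using bij_betwE[OF component_isosD(1)[OF f]] that by blast
    have "component_isos (\<lambda>g. g) ?L ?L' (\<lambda>g s. ?I' g (f g (J g s)))"
      unfolding component_isos_def
    proof (intro conjI allI ballI)
      fix g
      show "bij_betw (\<lambda>s. ?I' g (f g (J g s))) (homog ?L g) (homog ?L' g)"
        using bij_betw_trans[OF bij_betw_trans[OF J(1) component_isosD(1)[OF f]] I']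
        by (simp add: comp_def)
      show "linear_on (homog ?L g) (\<lambda>s. ?I' g (f g (J g s)))"
        by (rule linear_on_compose[OF linear_on_compose[OF J(2) component_isosD(2)[OF f]] linI'])
          (use bij_betwE[OF J(1)] fA in blast)+
    next
      fix g h s t assume "s \<in> homog ?L g" "t \<in> homog ?L h"
      then obtain a b where a: "a \<in> homog A (\<pi> g)" "s = ?I g a"
        and b: "b \<in> homog A (\<pi> h)" "t = ?I h b"
        by (auto simp: loop_component_def)
      obtain \<epsilon> where \<epsilon>:
        "tensor_mul (mul A) (?I g a) (?I h b) = ?I (g + h) (\<epsilon> *\<^sub>R mul A a b)"
        "tensor_mul (mul A') (?I' g (f g a)) (?I' h (f h b)) =
          ?I' (g + h) (\<epsilon> *\<^sub>R mul A' (f g a) (f h b))"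
        using mulI[of g h] a(1) b(1) fA by blast
      \<comment> \<open>Here \<epsilon> is carried through the linear maps and appears equally on
        both sides.\<close>
      have "J (g + h) (?I (g + h) (\<epsilon> *\<^sub>R mul A a b)) = \<epsilon> *\<^sub>R mul A a b"
        by (rule JI[OF subspace_scale[OF D(2) mulA[OF a(1) b(1)]]])
      moreover have "f (g + h) (\<epsilon> *\<^sub>R mul A a b) = \<epsilon> *\<^sub>R mul A' (f g a) (f h b)"
        using component_isosD(2)[OF f, of "g + h"] mulA[OF a(1) b(1)] component_isosD(3)[OF f a(1) b(1)]
        by (simp add: linear_on_def)
      ultimately show "?I' (g + h) (f (g + h) (J (g + h) (mul ?L s t))) =
          mul ?L' (?I' g (f g (J g s))) (?I' h (f h (J h t)))"
        using JI[OF a(1)] JI[OF b(1)] by (simp add: a(2) b(2) \<epsilon>)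
    qed
    then show "\<exists>f. component_isos (\<lambda>g. g) ?L ?L' f" by blast
  qed
  then show ?thesis
    using graded_isomorphic_iff_component_isos[OF graded_real_alg_loop_alg[OF \<pi> \<psi> norm_z z_sq A]
        graded_real_alg_loop_alg[OF \<pi> \<psi> norm_z z_sq A']] by simp
qed

section \<open>Annihilator and centroid\<close>

text \<open>The two-sided annihilator is an ideal, and it is proper because a simple algebra has a
  nonzero product.\<close>

lemma annihilator_zero:
  assumes A: "real_alg A" "simple_alg A" and d: "d \<in> carr A"
    and ann: "\<And>x. x \<in> carr A \<Longrightarrow> mul A d x = 0 \<and> mul A x d = 0"
  shows "d = 0"
proof -
  let ?I = "{d \<in> carr A. \<forall>x\<in>carr A. mul A d x = 0 \<and> mul A x d = 0}"
  note D = real_algD[OF A(1)]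
  have z: "mul A 0 x = 0" "mul A x 0 = 0" if "x \<in> carr A" for x
    using D(5,6)[OF that that, of 0] D(5)[OF that subspace_0[OF D(1)], of 0]
      D(6)[OF subspace_0[OF D(1)] that, of 0] by simp_all
  have "subspace ?I"
    unfolding subspace_def using D z by (auto simp: subspace_0 subspace_add subspace_scale)
  then have "alg_ideal A ?I"
    unfolding alg_ideal_def using D(1) z by (auto simp: subspace_0)
  moreover have "?I \<noteq> carr A"
    using A(2) unfolding simple_alg_def by blast
  ultimately have "?I = {0}"
    using A(2) unfolding simple_alg_def by blast
  then show ?thesis using d ann by blast
qed

text \<open>That \<open>f\<^sub>g\<inverse> \<circ> f\<^sub>g\<^sub>+\<^sub>k\<close> depends only on \<open>\<pi> g\<close> is due to the triviality of the annihilator.\<close>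

lemma component_isos_shift:
  assumes \<pi>: "Modules.additive \<pi>" "surj \<pi>" and A: "graded_real_alg A" "central_simple A"
    and f: "component_isos \<pi> A A' f" and k: "\<pi> k = 0"
  obtains r where "\<And>g a. a \<in> homog A (\<pi> g) \<Longrightarrow> f (g + k) a = r *\<^sub>R f g a"
proof -
  note alg = graded_real_algD(1)[OF A(1)]
  note D = real_algD[OF alg]
  have simple: "simple_alg A" using A(2) unfolding central_simple_def by blast
  have \<pi>_add: "\<pi> (g + h) = \<pi> g + \<pi> h" for g h using \<pi>(1) by (simp add: Modules.additive.add)
  have im: "f g a \<in> homog A' (\<pi> g)" if "a \<in> homog A (\<pi> g)" for g a
    using component_isosD(1)[OF f, of g] that by (auto simp: bij_betw_def)
  \<comment> \<open>Since \<open>\<pi> (g + k) = \<pi> g\<close>, the maps \<open>f g\<close> and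
    \<open>f (g + k)\<close> have the same domain and range, so \<open>t g\<close> maps the
    component to itself.\<close>
  define t where "t = (\<lambda>g a. inv_into (homog A (\<pi> g)) (f g) (f (g + k) a))"
  have t: "t g a \<in> homog A (\<pi> g)" "f g (t g a) = f (g + k) a" if "a \<in> homog A (\<pi> g)" for g a
    using component_isosD(1)[OF f, of g] im[of a "g + k"] that
    by (auto simp: t_def bij_betw_def \<pi>_add k inv_into_into f_inv_into_f)
  have t_lin: "linear_on (homog A (\<pi> g)) (t g)" for g
    unfolding t_def
    by (rule linear_on_compose[OF _ linear_on_inv_into[OF graded_real_algD(2)[OF A(1)]
          component_isosD(2,1)[OF f]]])
      (use component_isosD(2)[OF f, of "g + k"] im[of _ "g + k"] in \<open>auto simp: \<pi>_add k\<close>)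
  \<comment> \<open>These are the centroid identities on homogeneous elements; they come from
    splitting \<open>g + h + k\<close> as \<open>(g + k) + h\<close> or as
    \<open>g + (h + k)\<close>.\<close>
  have t_mul: "t (g + h) (mul A a b) = mul A (t g a) b" "t (g + h) (mul A a b) = mul A a (t h b)"
    if a: "a \<in> homog A (\<pi> g)" and b: "b \<in> homog A (\<pi> h)" for g h a b
  proof -
    have ab: "mul A a b \<in> homog A (\<pi> (g + h))" "mul A (t g a) b \<in> homog A (\<pi> (g + h))"
      "mul A a (t h b) \<in> homog A (\<pi> (g + h))"
      using graded_real_algD(4)[OF A(1)] a b t(1) by (simp_all add: \<pi>_add)
    have inj: "inj_on (f (g + h)) (homog A (\<pi> (g + h)))"
      using component_isosD(1)[OF f] by (simp add: bij_betw_def)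
    have "f (g + h + k) (mul A a b) = mul A' (f (g + k) a) (f h b)"
      "f (g + h + k) (mul A a b) = mul A' (f g a) (f (h + k) b)"
      using component_isosD(3)[OF f, of a "g + k" b h] component_isosD(3)[OF f, of a g b "h + k"]
        a b by (simp_all add: \<pi>_add k ac_simps)
    then have "f (g + h) (t (g + h) (mul A a b)) = f (g + h) (mul A (t g a) b)"
      "f (g + h) (t (g + h) (mul A a b)) = f (g + h) (mul A a (t h b))"
      using component_isosD(3)[OF f] t a b ab by simp_all
    then show "t (g + h) (mul A a b) = mul A (t g a) b" "t (g + h) (mul A a b) = mul A a (t h b)"
      using inj t(1)[OF ab(1)] ab(2,3) by (metis inj_onD)+
  qed
  have t_indep: "t g a = t g' a" if a: "a \<in> homog A (\<pi> g)" and eq: "\<pi> g = \<pi> g'" for g g' a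
  proof -
    have a': "a \<in> homog A (\<pi> g')" using a eq by simp
    have mem: "a \<in> carr A" "t g a \<in> carr A" "t g' a \<in> carr A"
      using t(1)[OF a] t(1)[OF a'] a graded_real_algD(3)[OF A(1)] by blast+
    \<comment> \<open>For \<open>x\<close> of degree \<open>\<pi> h\<close>, moving \<open>t\<close>
      to the other factor gives \<open>mul A a (t h x)\<close> and \<open>mul A (t h x) a\<close>,
      in which g no longer occurs.\<close>
    have *: "mul A (t g a) x = mul A (t g' a) x \<and> mul A x (t g a) = mul A x (t g' a)"
      if "x \<in> carr A" for x
      using A(1) that
    proof (induction rule: graded_induct)
      case (homog l x)
      obtain h where "l = \<pi> h" using \<pi>(2) by (metis surjD)
      then show ?case using t_mul a a' homog by metis
    next
      case (add x y)
      then show ?case using D mem by simp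
    qed
    have "t g a - t g' a = 0"
    proof (rule annihilator_zero[OF alg simple])
      show "t g a - t g' a \<in> carr A" using mem D(1) by (simp add: subspace_diff)
      fix x assume x: "x \<in> carr A"
      \<comment> \<open>Writing the negative as a scalar multiple makes the bilinearity rules in
        \<open>D\<close> applicable.\<close>
      have m: "- t g' a = (- 1) *\<^sub>R t g' a" by simp
      have "(- 1) *\<^sub>R t g' a \<in> carr A" using mem D(1) by (blast intro: subspace_scale)
      then show "mul A (t g a - t g' a) x = 0 \<and> mul A x (t g a - t g' a) = 0"
        unfolding diff_conv_add_uminus m using mem x *[OF x] by (simp only: D) simp
    qed
    then show ?thesis by simp
  qed
  \<comment> \<open>The maps \<open>t\<close> are glued to one operator on the whole algebra; by
    \<open>t_indep\<close> the preimage chosen by \<open>inv \<pi>\<close> is immaterial.\<close>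
  define T where "T = homog_extend A (\<lambda>l. t (inv \<pi> l))"
  have \<pi>_inv: "\<pi> (inv \<pi> l) = l" for l using \<pi>(2) by (rule surj_f_inv_f)
  have lin_comp: "linear_on (homog A l) (t (inv \<pi> l))" for l
    using t_lin[of "inv \<pi> l"] by (simp add: \<pi>_inv)
  have T_homog: "T a = t g a" if a: "a \<in> homog A (\<pi> g)" for g a
    using homog_extend_homog[where F = "\<lambda>l. t (inv \<pi> l)", OF A(1) lin_comp a] t_indep[OF a, of "inv \<pi> (\<pi> g)"]
    by (simp add: T_def \<pi>_inv)
  have T_lin: "linear_on (carr A) T"
    unfolding T_def by (rule linear_on_homog_extend[OF A(1) lin_comp])
  have T_carr: "T x \<in> carr A" if "x \<in> carr A" for x
    using A(1) that
  proof (induction rule: graded_induct)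
    case (homog l x)
    then have "x \<in> homog A (\<pi> (inv \<pi> l))" by (simp add: \<pi>_inv)
    then show ?case using T_homog t(1) graded_real_algD(3)[OF A(1)] by metis
  next
    case (add x y)
    then show ?case using T_lin D(1) by (simp add: linear_on_def subspace_add)
  qed
  have T_mul_homog: "T (mul A x y) = mul A x (T y) \<and> T (mul A x y) = mul A (T x) y"
    if x: "x \<in> homog A l" and y: "y \<in> carr A" for x y l
    using A(1) y
  proof (induction rule: graded_induct)
    case (homog m y)
    obtain g h where gh: "l = \<pi> g" "m = \<pi> h" using \<pi>(2) by (metis surjD)
    have "mul A x y \<in> homog A (\<pi> (g + h))"
      using graded_real_algD(4)[OF A(1) x homog] by (simp add: gh \<pi>_add)
    then show ?case
      using T_homog t_mul x homog unfolding gh by metis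
  next
    case (add y w)
    have "x \<in> carr A" using graded_real_algD(3)[OF A(1) x] .
    \<comment> \<open>Each induction hypothesis describes \<open>T\<close> of a product in two ways;
      equating them lets both required identities be reduced to the same expression.\<close>
    moreover have "mul A (T x) y = mul A x (T y)" "mul A (T x) w = mul A x (T w)"
      using add.IH by auto
    ultimately show ?case using add D T_lin T_carr by (simp add: linear_on_def)
  qed
  have T_mul: "T (mul A x y) = mul A x (T y) \<and> T (mul A x y) = mul A (T x) y"
    if x: "x \<in> carr A" and y: "y \<in> carr A" for x y
    using A(1) x
  proof (induction rule: graded_induct)
    case (homog l x)
    then show ?case using T_mul_homog y by blast
  next
    case (add x w)
    moreover have "mul A (T x) y = mul A x (T y)" "mul A (T w) y = mul A w (T y)"
      using add.IH by auto
    ultimately show ?case using y D T_lin T_carr by (simp add: linear_on_def)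
  qed
  \<comment> \<open>Elements of \<open>centroid\<close> are \<open>undefined\<close> off the
    carrier, hence the restriction. Centrality now supplies the scalar.\<close>
  have "restrict T (carr A) \<in> centroid A"
    unfolding centroid_def mem_Collect_eq
  proof (intro conjI ballI)
    show "linear_on (carr A) (restrict T (carr A))"
      using T_lin D(1) by (simp add: linear_on_def subspace_add subspace_scale)
    fix x y assume "x \<in> carr A" "y \<in> carr A"
    then show "restrict T (carr A) (mul A x y) = mul A x (restrict T (carr A) y)"
      "restrict T (carr A) (mul A x y) = mul A (restrict T (carr A) x) y"
      using T_mul[of x y] D(2) by (metis restrict_apply')+
  qed (use T_carr in auto)
  then obtain r where "restrict T (carr A) = restrict (\<lambda>x. r *\<^sub>R x) (carr A)"
    using A(2) unfolding central_simple_def by auto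
  then have r: "T x = r *\<^sub>R x" if "x \<in> carr A" for x
    using that by (metis restrict_apply')
  \<comment> \<open>As \<open>T\<close> is a single operator, the same \<open>r\<close> works for
    every g; applying \<open>f g\<close> to \<open>t g a = r *\<^sub>R a\<close> gives the
    claim.\<close>
  have "f (g + k) a = r *\<^sub>R f g a" if a: "a \<in> homog A (\<pi> g)" for g a
  proof -
    have "t g a = r *\<^sub>R a"
      using T_homog[OF a] r[OF graded_real_algD(3)[OF A(1) a]] by simp
    then show ?thesis
      using t(2)[OF a] component_isosD(2)[OF f, of g] a by (simp add: linear_on_def)
  qed
  then show ?thesis by (rule that)
qed

section \<open>From component families to twists and back\<close>

text \<open>The sum \<open>\<xi> g + \<xi> h\<close> exceeds \<open>\<xi> (g + h)\<close> by the
  cocycle value, which lies in the kernel. Passing between the two indices costs \<nu> of that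
  value, exactly the factor in the twisted product.\<close>

lemma component_isos_imp_twist:
  assumes \<pi>: "Modules.additive \<pi>" "surj \<pi>" and \<xi>: "\<And>h. \<pi> (\<xi> h) = h"
    and A: "graded_real_alg A" "central_simple A" and A': "graded_real_alg A'"
    and f: "component_isos \<pi> A A' f"
  obtains \<nu> where "real_character_on (ker \<pi>) \<nu>" "graded_isomorphic A' (twist \<xi> \<nu> A)"
proof -
  note alg = graded_real_algD(1)[OF A(1)]
  note D = real_algD[OF alg]
  have \<pi>_add: "\<pi> (g + h) = \<pi> g + \<pi> h" for g h using \<pi>(1) by (simp add: Modules.additive.add)
  have \<pi>_diff: "\<pi> (g - h) = \<pi> g - \<pi> h" for g h using \<pi>(1) by (simp add: Modules.additive.diff)
  \<comment> \<open>The condition on \<open>k\<close> stands inside the existential so that choice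
    yields a total \<nu>, with arbitrary values off the kernel.\<close>
  have "\<forall>k. \<exists>r. \<pi> k = 0 \<longrightarrow> (\<forall>g. \<forall>a\<in>homog A (\<pi> g). f (g + k) a = r *\<^sub>R f g a)"
    using component_isos_shift[OF \<pi> A f] by metis
  then obtain \<nu> where \<nu>: "\<And>k g a. \<lbrakk>\<pi> k = 0; a \<in> homog A (\<pi> g)\<rbrakk> \<Longrightarrow> f (g + k) a = \<nu> k *\<^sub>R f g a"
    by metis
  \<comment> \<open>A nonzero homogeneous element is needed to compare scalars; without one all
    products would vanish.\<close>
  obtain g0 a0 where a0: "a0 \<in> homog A (\<pi> g0)" "a0 \<noteq> 0"
  proof -
    have "\<exists>l. \<exists>a\<in>homog A l. a \<noteq> 0"
    proof (rule ccontr)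
      assume neg: "\<not> ?thesis"
      have "x = 0" if "x \<in> carr A" for x
        using A(1) that by (induction rule: graded_induct) (use neg in auto)
      then show False
        using A(2) D(2) unfolding central_simple_def simple_alg_def by blast
    qed
    then show thesis using that \<xi> by metis
  qed
  have nz: "f g a0 \<noteq> 0" if "\<pi> g = \<pi> g0" for g
  proof -
    have "f g 0 = 0"
      by (rule linear_on_0[OF graded_real_algD(2)[OF A(1)] component_isosD(2)[OF f]])
    moreover have "inj_on (f g) (homog A (\<pi> g))"
      using component_isosD(1)[OF f] by (simp add: bij_betw_def)
    ultimately show ?thesis
      using a0 that subspace_0[OF graded_real_algD(2)[OF A(1)]] by (metis inj_onD)
  qed
  have "real_character_on (ker \<pi>) \<nu>"
    unfolding real_character_on_def ker_def mem_Collect_eq Ball_def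
  proof (intro conjI allI impI)
    fix k assume k: "\<pi> k = 0"
    then show "\<nu> k \<noteq> 0" using \<nu>[OF k a0(1)] nz[of "g0 + k"] by (auto simp: \<pi>_add)
    fix l assume l: "\<pi> l = 0"
    \<comment> \<open>The index \<open>g0\<close> is shifted by \<open>k + l\<close> at once, or by
      \<open>k\<close> and then by \<open>l\<close>.\<close>
    have "\<nu> (k + l) *\<^sub>R f g0 a0 = (\<nu> k * \<nu> l) *\<^sub>R f g0 a0"
      using \<nu>[of "k + l" a0 g0] \<nu>[OF k a0(1)] \<nu>[of l a0 "g0 + k"] k l a0(1)
      by (simp add: \<pi>_add add.assoc mult.commute)
    then show "\<nu> (k + l) = \<nu> k * \<nu> l" using nz by simp
  qed
  moreover have "graded_isomorphic A' (twist \<xi> \<nu> A)"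
  proof -
    have [simp]: "homog (twist \<xi> \<nu> A) = homog A" by (simp add: twist_def)
    have "component_isos (\<lambda>h. h) (twist \<xi> \<nu> A) A' (\<lambda>h. f (\<xi> h))"
      unfolding component_isos_def
    proof (intro conjI allI ballI)
      fix h
      show "bij_betw (f (\<xi> h)) (homog (twist \<xi> \<nu> A) h) (homog A' h)"
        "linear_on (homog (twist \<xi> \<nu> A) h) (f (\<xi> h))"
        using component_isosD(1,2)[OF f, of "\<xi> h"] by (simp_all add: \<xi>)
    next
      fix g h x y assume x: "x \<in> homog (twist \<xi> \<nu> A) g" and y: "y \<in> homog (twist \<xi> \<nu> A) h"
      let ?\<sigma> = "section_cocycle \<xi> g h"
      have xy: "mul A x y \<in> homog A (\<pi> (\<xi> (g + h)))"
        using graded_real_algD(4)[OF A(1)] x y by (simp add: \<xi>)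
      have "f (\<xi> (g + h)) (mul (twist \<xi> \<nu> A) x y) = \<nu> ?\<sigma> *\<^sub>R f (\<xi> (g + h)) (mul A x y)"
        using twist_mul_homogeneous[OF A(1), of x g y h \<xi> \<nu>] x y xy
          component_isosD(2)[OF f, of "\<xi> (g + h)"]
        by (simp add: linear_on_def)
      \<comment> \<open>The twisting scalar is absorbed as a shift of the index by an element of the
        kernel.\<close>
      also have "\<dots> = f (\<xi> (g + h) + ?\<sigma>) (mul A x y)"
        using \<nu>[OF _ xy, of ?\<sigma>] by (simp add: section_cocycle_def \<pi>_add \<pi>_diff \<xi>)
      also have "\<dots> = mul A' (f (\<xi> g) x) (f (\<xi> h) y)"
        using component_isosD(3)[OF f, of x "\<xi> g" y "\<xi> h"] x y
        by (simp add: section_cocycle_def \<xi>)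
      finally show "f (\<xi> (g + h)) (mul (twist \<xi> \<nu> A) x y) = mul A' (f (\<xi> g) x) (f (\<xi> h) y)" .
    qed
    from component_isos_inv_into[OF _ graded_real_alg_twist[OF A(1)] this] show ?thesis
      unfolding graded_isomorphic_iff_component_isos[OF A' graded_real_alg_twist[OF A(1)]]
      by (auto simp: Modules.additive_def)
  qed
  ultimately show thesis by (rule that)
qed

text \<open>An isomorphism from the twist is multiplicative only up to \<nu> of the cocycle;
  rescaling it in each degree g of G by \<open>c g\<close> removes this defect.\<close>

lemma twist_imp_component_isos:
  assumes \<pi>: "Modules.additive \<pi>" and \<xi>: "\<And>h. \<pi> (\<xi> h) = h"
    and A: "graded_real_alg A" and A': "graded_real_alg A'"
    and \<nu>: "real_character_on (ker \<pi>) \<nu>" and iso: "graded_isomorphic A' (twist \<xi> \<nu> A)"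
  obtains f where "component_isos \<pi> A A' f"
proof -
  have \<pi>_add: "\<pi> (g + h) = \<pi> g + \<pi> h" for g h using \<pi> by (simp add: Modules.additive.add)
  have \<pi>_diff: "\<pi> (g - h) = \<pi> g - \<pi> h" for g h using \<pi> by (simp add: Modules.additive.diff)
  have [simp]: "homog (twist \<xi> \<nu> A) = homog A" by (simp add: twist_def)
  \<comment> \<open>The given isomorphism starts at \<open>A'\<close>, so its family is
    inverted.\<close>
  obtain \<theta> where \<theta>: "component_isos (\<lambda>h. h) (twist \<xi> \<nu> A) A' \<theta>"
    using iso component_isos_inv_into[OF _ A', of "\<lambda>h. h"]
    unfolding graded_isomorphic_iff_component_isos[OF A' graded_real_alg_twist[OF A]]
    by (auto simp: Modules.additive_def)
  note \<theta>_bij = component_isosD(1)[OF \<theta>, simplified] and \<theta>_lin = component_isosD(2)[OF \<theta>, simplified]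
  \<comment> \<open>The element \<open>g - \<xi> (\<pi> g)\<close> of the kernel measures how far g
    is from the section, so \<nu> may be evaluated there.\<close>
  define c where "c g = \<nu> (g - \<xi> (\<pi> g))" for g
  have c0: "c g \<noteq> 0" for g
    using \<nu> unfolding real_character_on_def c_def ker_def by (simp add: \<pi>_diff \<xi>)
  have c_mul: "c (g + h) = c g * c h * \<nu> (section_cocycle \<xi> (\<pi> g) (\<pi> h))" for g h
  proof -
    have \<nu>_add: "\<nu> (k + l) = \<nu> k * \<nu> l" if "\<pi> k = 0" "\<pi> l = 0" for k l
      using \<nu> that unfolding real_character_on_def ker_def by simp
    \<comment> \<open>All three summands lie in the kernel, where \<nu> is multiplicative.\<close>
    have "g + h - \<xi> (\<pi> (g + h)) =
        ((g - \<xi> (\<pi> g)) + (h - \<xi> (\<pi> h))) + section_cocycle \<xi> (\<pi> g) (\<pi> h)"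
      by (simp add: section_cocycle_def \<pi>_add)
    moreover have "\<pi> (g - \<xi> (\<pi> g)) = 0" "\<pi> (h - \<xi> (\<pi> h)) = 0"
      "\<pi> (section_cocycle \<xi> (\<pi> g) (\<pi> h)) = 0"
      by (simp_all add: section_cocycle_def \<pi>_add \<pi>_diff \<xi>)
    ultimately show ?thesis
      unfolding c_def by (simp only: \<nu>_add \<pi>_add add_0_right)
  qed
  have "component_isos \<pi> A A' (\<lambda>g x. c g *\<^sub>R \<theta> (\<pi> g) x)"
    unfolding component_isos_def
  proof (intro conjI allI ballI)
    fix g
    have "bij_betw (\<lambda>y. c g *\<^sub>R y) (homog A' (\<pi> g)) (homog A' (\<pi> g))"
      by (rule bij_betw_byWitness[of _ "\<lambda>y. inverse (c g) *\<^sub>R y"])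
        (use c0 graded_real_algD(2)[OF A'] in \<open>auto simp: subspace_scale\<close>)
    from bij_betw_trans[OF \<theta>_bij this]
    show "bij_betw (\<lambda>x. c g *\<^sub>R \<theta> (\<pi> g) x) (homog A (\<pi> g)) (homog A' (\<pi> g))"
      by (simp add: comp_def)
    show "linear_on (homog A (\<pi> g)) (\<lambda>x. c g *\<^sub>R \<theta> (\<pi> g) x)"
      using \<theta>_lin[of "\<pi> g"] by (simp add: linear_on_def scaleR_add_right)
  next
    fix g h x y assume x: "x \<in> homog A (\<pi> g)" and y: "y \<in> homog A (\<pi> h)"
    let ?\<sigma> = "section_cocycle \<xi> (\<pi> g) (\<pi> h)"
    have xy: "mul A x y \<in> homog A (\<pi> g + \<pi> h)"
      using graded_real_algD(4)[OF A x y] .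
    have carr: "\<theta> (\<pi> g) x \<in> carr A'" "\<theta> (\<pi> h) y \<in> carr A'"
      using bij_betwE[OF \<theta>_bij] x y graded_real_algD(3)[OF A'] by blast+
    have "\<nu> ?\<sigma> *\<^sub>R \<theta> (\<pi> g + \<pi> h) (mul A x y) = \<theta> (\<pi> g + \<pi> h) (mul (twist \<xi> \<nu> A) x y)"
      using twist_mul_homogeneous[OF A x y, of \<xi> \<nu>] xy \<theta>_lin[of "\<pi> g + \<pi> h"]
      by (simp add: linear_on_def)
    also have "\<dots> = mul A' (\<theta> (\<pi> g) x) (\<theta> (\<pi> h) y)"
      using component_isosD(3)[OF \<theta>] x y by simp
    \<comment> \<open>By \<open>c_mul\<close>, the factor by which \<open>c (g + h)\<close> differs
      from \<open>c g * c h\<close> is the one that the twisted product supplies.\<close>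
    finally have "c (g + h) *\<^sub>R \<theta> (\<pi> (g + h)) (mul A x y) =
        (c g * c h) *\<^sub>R mul A' (\<theta> (\<pi> g) x) (\<theta> (\<pi> h) y)"
      by (metis c_mul \<pi>_add scaleR_scaleR)
    also have "\<dots> = mul A' (c g *\<^sub>R \<theta> (\<pi> g) x) (c h *\<^sub>R \<theta> (\<pi> h) y)"
      using carr real_algD[OF graded_real_algD(1)[OF A']] by (simp add: subspace_scale)
    finally show "c (g + h) *\<^sub>R \<theta> (\<pi> (g + h)) (mul A x y) =
        mul A' (c g *\<^sub>R \<theta> (\<pi> g) x) (c h *\<^sub>R \<theta> (\<pi> h) y)" .
  qed
  then show thesis by (rule that)
qed

theorem corollary3p10:
  fixes \<pi> :: "'g::ab_group_add \<Rightarrow> 'h::ab_group_add"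
    and \<psi> :: "'g \<Rightarrow> complex"
    and z :: "'g \<Rightarrow> complex"
    and \<xi> :: "'h \<Rightarrow> 'g"
    and A :: "('v::real_vector, 'h) graded_alg"
    and A' :: "('w::real_vector, 'h) graded_alg"
  assumes "Modules.additive \<pi>" and "surj \<pi>"
    and "unitary_character \<psi>"
    and "\<And>g. cmod (z g) = 1" and "\<And>g. (z g)\<^sup>2 = \<psi> g"
    and "\<And>h. \<pi> (\<xi> h) = h"
    and "graded_real_alg A" and "central_simple A"
    and "graded_real_alg A'" and "central_simple A'"
  shows "graded_isomorphic (loop_alg \<pi> z A) (loop_alg \<pi> z A') \<longleftrightarrow>
    (\<exists>\<nu>. real_character_on (ker \<pi>) \<nu> \<and> graded_isomorphic A' (twist \<xi> \<nu> A))"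
  unfolding loop_alg_isomorphic_iff_component_isos[OF assms(1,3,4,5,7,9)]
  using component_isos_imp_twist[OF assms(1,2,6,7,8,9)]
    twist_imp_component_isos[OF assms(1,6,7,9)]
  by metis

end
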